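(* The following hold. \begin{enumerate} \item Let $G$ be a $d$-generated group with generating set $X$, $|X|=d$, let $k\in\mathbb{N}$, and let $E$ be the standard generating set (the standard basis) of $\mathbb{Z}^k$. Then $pw(G\wr\mathbb{Z}^k, X\cup E)\le 5d+9k$ if $k$ is even, and $pw(G\wr\mathbb{Z}^k, X\cup E)\le 5d+9k+2$ if $k$ is odd. \item Let $A$ be an $r$-generated infinite abelian group generated by a set $T$ with $|T|=r$, and let $C$ be a finitely generated group with finite commutator width $n$. Then $pw(C\wr A, T\cup Y)\le 5|Y|+6r+7n$ for any finite generating set $Y$ of $C$. \item Let $G$ be a finitely generated group with generating set $Y$ and let $H$ be a non-abelian finitely generated group with finite palindromic width with respect to a generating set $Z$. Then there is an element $c\in H$ (possibly $c=1$) such that every element of the subgroup $G'\wr H$ of $G\wr H$ can be written as a product of at most $pw(H,Z)+1$ palindromes with respect to the generating set $Z\cup\{c\}\cup Y$ of $G\wr H$, where $G'=[G,G]$. \item Let $P$ be a finitely generated perfect group and let $H$ be a non-abelian finitely generated group with finite palindromic width with respect to a generating set $Z$. Then for any generating set $S$ of $P$ there is an element $c\in H$ (possibly $c=1$) such that $pw(P\wr H, Z\cup\{c\}\cup S)\le pw(H,Z)+1$. \item Let $K$ be a non-abelian finite group and let $G$ be a $d$-generated group. Then $G\wr K$ has finite palindromic width with respect to the natural generating set, that is, the union of a generating set of $K$ and a generating set of $G$. \end{enumerate}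
   Context: Wreath products: $B\wr A$ denotes the regular (restricted) wreath product $F\rtimes A$, where $F$ is the group of finitely supported functions $A\to B$ (a direct sum of copies of $B$ indexed by $A$) and $A$ acts on $F$ by permuting coordinates via left multiplication on itself. $B$ is identified with the copy of $B$ in the coordinate indexed by $1\in A$; every element can be written as $a\prod_{i=1}^k a_i^{-1} f_i a_i$ with $a,a_i\in A$ and $f_i\in B$. If $X$ generates $A$ and $Y$ generates $B$, then $X\cup Y$ (each set viewed inside $B\wr A$) generates $B\wr A$ and is called the natural generating set. For $B_0\le B$, $B_0\wr A$ is regarded as the subgroup of $B\wr A$ of elements whose base-group coordinates all lie in $B_0$. Palindromes: let $G$ be a group with generating set $X$. A word $x_{1}^{\epsilon_1}\cdots x_{m}^{\epsilon_m}$ with $x_i\in X$, $\epsilon_i\in\{\pm1\}$ is a palindrome if it equals its reverse $x_{m}^{\epsilon_m}\cdots x_{1}^{\epsilon_1}$ (letters in opposite order, exponents unchanged). An element of $G$ is a palindrome with respect to $X$ if it is represented by some palindromic word in $X$. $G$ has finite palindromic width with respect to $X$ if there is a constant $N$ such that every element of $G$ is a product of at most $N$ palindromes with respect to $X$; the least such $N$ is $pw(G,X)$. Commutator width: $C$ has finite commutator width $n$ if $n$ is the least integer such that every element of $C'=[C,C]$ is a product of at most $n$ commutators. A group $P$ is perfect if $P=[P,P]$.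
   Formalization: In item 5 the generating set of K is any generating set Z enlarged by a suitable c in K (as in items 3, 4), with any generating set of G; for arbitrary Z the claim fails (K = S_3 with transpositions, G free of rank 2). In item 1, k is at least 1. *)

theory Defs
  imports "HOL-Algebra.Product_Groups" "HOL-Library.Extended_Nat"
begin

section \<open>Generating sets and products of bounded length\<close>

definition generates :: "('a, 'm) monoid_scheme \<Rightarrow> 'a set \<Rightarrow> bool" where
  "generates G X \<longleftrightarrow> X \<subseteq> carrier G \<and> generate G X = carrier G"

definition finitely_generated :: "('a, 'm) monoid_scheme \<Rightarrow> bool" where
  "finitely_generated G \<longleftrightarrow> (\<exists>X. finite X \<and> generates G X)"

definition d_generated :: "nat \<Rightarrow> ('a, 'm) monoid_scheme \<Rightarrow> bool" where
  "d_generated d G \<longleftrightarrow> (\<exists>X. finite X \<and> card X \<le> d \<and> generates G X)"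

definition list_prod :: "('a, 'm) monoid_scheme \<Rightarrow> 'a list \<Rightarrow> 'a" where
  "list_prod G xs = foldr (mult G) xs \<one>\<^bsub>G\<^esub>"

definition products_le :: "('a, 'm) monoid_scheme \<Rightarrow> 'a set \<Rightarrow> enat \<Rightarrow> 'a set" where
  "products_le G S N = {list_prod G xs | xs. set xs \<subseteq> S \<and> enat (length xs) \<le> N}"

text \<open>The least \<open>N\<close> such that every element of \<open>T\<close> is a product of at most \<open>N\<close> elements
  of \<open>S\<close>; it is \<open>\<infinity>\<close> (the infimum of the empty set) if there is no such \<open>N\<close>.\<close>

definition width :: "('a, 'm) monoid_scheme \<Rightarrow> 'a set \<Rightarrow> 'a set \<Rightarrow> enat" where
  "width G T S = Inf {enat N | N. T \<subseteq> products_le G S (enat N)}"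


section \<open>Palindromes\<close>

text \<open>The pair \<open>(x, e)\<close> with \<open>e \<in> {1, -1}\<close> stands for the letter \<open>x\<^sup>e\<close>. Reversing a word leaves
  the exponents unchanged.\<close>

definition words :: "'a set \<Rightarrow> ('a \<times> int) list set" where
  "words X = lists (X \<times> {1, -1})"

definition word_value :: "('a, 'm) monoid_scheme \<Rightarrow> ('a \<times> int) list \<Rightarrow> 'a" where
  "word_value G w = list_prod G (map (\<lambda>(x, e). x [^]\<^bsub>G\<^esub> e) w)"

definition palindromes :: "('a, 'm) monoid_scheme \<Rightarrow> 'a set \<Rightarrow> 'a set" where
  "palindromes G X = {word_value G w | w. w \<in> words X \<and> rev w = w}"

definition finite_pw :: "('a, 'm) monoid_scheme \<Rightarrow> 'a set \<Rightarrow> bool" where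
  "finite_pw G X \<longleftrightarrow> (\<exists>N::nat. \<forall>g\<in>carrier G. g \<in> products_le G (palindromes G X) (enat N))"

definition pw :: "('a, 'm) monoid_scheme \<Rightarrow> 'a set \<Rightarrow> enat" where
  "pw G X = width G (carrier G) (palindromes G X)"


section \<open>Commutators\<close>

definition commutator_width :: "('a, 'm) monoid_scheme \<Rightarrow> enat" where
  "commutator_width G = width G (derived G (carrier G)) (derived_set G (carrier G))"

definition perfect :: "('a, 'm) monoid_scheme \<Rightarrow> bool" where
  "perfect G \<longleftrightarrow> derived G (carrier G) = carrier G"


section \<open>Restricted regular wreath products\<close>

text \<open>The pair \<open>(f, a)\<close> is the product \<open>f a\<close> with \<open>f\<close> in the base group. Conjugation
  \<open>f \<mapsto> a f a\<^sup>-\<^sup>1\<close> moves the entry of \<open>f\<close> at \<open>x\<close> to the coordinate \<open>a x\<close>.\<close>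

definition base_group ::
    "('b, 'm) monoid_scheme \<Rightarrow> ('a, 'n) monoid_scheme \<Rightarrow> ('a \<Rightarrow> 'b) monoid" where
  "base_group B A = sum_group (carrier A) (\<lambda>_. B)"

definition shift :: "('a, 'n) monoid_scheme \<Rightarrow> 'a \<Rightarrow> ('a \<Rightarrow> 'b) \<Rightarrow> 'a \<Rightarrow> 'b" where
  "shift A a f = (\<lambda>x\<in>carrier A. f (inv\<^bsub>A\<^esub> a \<otimes>\<^bsub>A\<^esub> x))"

definition wreath ::
    "('b, 'm) monoid_scheme \<Rightarrow> ('a, 'n) monoid_scheme \<Rightarrow> (('a \<Rightarrow> 'b) \<times> 'a) monoid"
    (infixl "\<wr>" 70) where
  "B \<wr> A = \<lparr>carrier = carrier (base_group B A) \<times> carrier A,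
     monoid.mult = (\<lambda>(f, a) (g, b). (f \<otimes>\<^bsub>base_group B A\<^esub> shift A a g, a \<otimes>\<^bsub>A\<^esub> b)),
     one = (\<one>\<^bsub>base_group B A\<^esub>, \<one>\<^bsub>A\<^esub>)\<rparr>"

definition in_top :: "('b, 'm) monoid_scheme \<Rightarrow> ('a, 'n) monoid_scheme \<Rightarrow> 'a \<Rightarrow> ('a \<Rightarrow> 'b) \<times> 'a" where
  "in_top B A a = (\<one>\<^bsub>base_group B A\<^esub>, a)"

definition in_base :: "('b, 'm) monoid_scheme \<Rightarrow> ('a, 'n) monoid_scheme \<Rightarrow> 'b \<Rightarrow> ('a \<Rightarrow> 'b) \<times> 'a" where
  "in_base B A b = (\<lambda>x\<in>carrier A. if x = \<one>\<^bsub>A\<^esub> then b else \<one>\<^bsub>B\<^esub>, \<one>\<^bsub>A\<^esub>)"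

text \<open>The union \<open>X \<union> Y\<close> of \<open>X \<subseteq> A\<close> and \<open>Y \<subseteq> B\<close>, both viewed inside \<open>B \<wr> A\<close>.\<close>

definition wreath_gens ::
    "('b, 'm) monoid_scheme \<Rightarrow> ('a, 'n) monoid_scheme \<Rightarrow> 'a set \<Rightarrow> 'b set \<Rightarrow> (('a \<Rightarrow> 'b) \<times> 'a) set" where
  "wreath_gens B A X Y = in_top B A ` X \<union> in_base B A ` Y"

definition wreath_sub ::
    "('b, 'm) monoid_scheme \<Rightarrow> ('a, 'n) monoid_scheme \<Rightarrow> 'b set \<Rightarrow> (('a \<Rightarrow> 'b) \<times> 'a) set" where
  "wreath_sub B A B0 = {(f, a) \<in> carrier (B \<wr> A). \<forall>x\<in>carrier A. f x \<in> B0}"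

lemma carrier_base_group:
  assumes "group B"
  shows "carrier (base_group B A) =
    {f \<in> carrier A \<rightarrow>\<^sub>E carrier B. finite {x \<in> carrier A. f x \<noteq> \<one>\<^bsub>B\<^esub>}}"
  using assms by (simp add: base_group_def carrier_sum_group)

lemma group_base_group: "group B \<Longrightarrow> group (base_group B A)"
  by (simp add: base_group_def)

lemma mult_base_group:
  "f \<otimes>\<^bsub>base_group B A\<^esub> g = (\<lambda>x\<in>carrier A. f x \<otimes>\<^bsub>B\<^esub> g x)"
  by (simp add: base_group_def)

lemma one_base_group: "\<one>\<^bsub>base_group B A\<^esub> = (\<lambda>x\<in>carrier A. \<one>\<^bsub>B\<^esub>)"
  by (simp add: base_group_def)

lemma shift_closed:
  assumes "group B" "group A" and a: "a \<in> carrier A" and f: "f \<in> carrier (base_group B A)"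
  shows "shift A a f \<in> carrier (base_group B A)"
proof -
  interpret A: group A by fact
  let ?S = "{x \<in> carrier A. f x \<noteq> \<one>\<^bsub>B\<^esub>}"
  have "{x \<in> carrier A. shift A a f x \<noteq> \<one>\<^bsub>B\<^esub>} \<subseteq> (\<lambda>x. a \<otimes>\<^bsub>A\<^esub> x) ` ?S"
  proof
    fix x assume "x \<in> {x \<in> carrier A. shift A a f x \<noteq> \<one>\<^bsub>B\<^esub>}"
    then have "x \<in> carrier A" "inv\<^bsub>A\<^esub> a \<otimes>\<^bsub>A\<^esub> x \<in> ?S" using a by (auto simp: shift_def)
    moreover have "x = a \<otimes>\<^bsub>A\<^esub> (inv\<^bsub>A\<^esub> a \<otimes>\<^bsub>A\<^esub> x)" if "x \<in> carrier A"
      using a that by (simp add: A.m_assoc[symmetric])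
    ultimately show "x \<in> (\<lambda>x. a \<otimes>\<^bsub>A\<^esub> x) ` ?S" by blast
  qed
  moreover have "finite ?S" using f by (simp add: carrier_base_group[OF \<open>group B\<close>])
  ultimately have "finite {x \<in> carrier A. shift A a f x \<noteq> \<one>\<^bsub>B\<^esub>}"
    using finite_surj by blast
  moreover have "shift A a f \<in> carrier A \<rightarrow>\<^sub>E carrier B"
    using f a by (auto simp: carrier_base_group[OF \<open>group B\<close>] shift_def)
  ultimately show ?thesis by (simp add: carrier_base_group[OF \<open>group B\<close>])
qed

lemma group_wreath:
  assumes "group B" "group A"
  shows "group (B \<wr> A)"
proof -
  interpret A: group A by fact
  interpret B: group B by fact
  interpret F: group "base_group B A" by (rule group_base_group) fact
  have val: "f x \<in> carrier B" if "f \<in> carrier (base_group B A)" "x \<in> carrier A" for f x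
    using that by (auto simp: carrier_base_group[OF \<open>group B\<close>])
  have ext: "(\<lambda>x\<in>carrier A. f x) = f" if "f \<in> carrier (base_group B A)" for f
    using that by (auto simp: carrier_base_group[OF \<open>group B\<close>] PiE_iff extensional_restrict)
  have shift_mult: "shift A a (f \<otimes>\<^bsub>base_group B A\<^esub> g)
      = shift A a f \<otimes>\<^bsub>base_group B A\<^esub> shift A a g"
    if "a \<in> carrier A" for a f g
    using that by (auto simp: shift_def mult_base_group)
  have shift_shift: "shift A a (shift A b f) = shift A (a \<otimes>\<^bsub>A\<^esub> b) f"
    if "a \<in> carrier A" "b \<in> carrier A" for a b f
    using that by (auto simp: shift_def A.inv_mult_group A.m_assoc intro!: restrict_ext)
  have shift_one: "shift A \<one>\<^bsub>A\<^esub> f = f" if "f \<in> carrier (base_group B A)" for f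
  proof -
    have "shift A \<one>\<^bsub>A\<^esub> f = (\<lambda>x\<in>carrier A. f x)"
      by (auto simp: shift_def intro!: restrict_ext)
    then show ?thesis using ext[OF that] by simp
  qed
  note cl = shift_closed[OF \<open>group B\<close> \<open>group A\<close>]
  show ?thesis
  proof (rule groupI)
    fix u assume "u \<in> carrier (B \<wr> A)"
    then obtain f a where u: "u = (f, a)" "f \<in> carrier (base_group B A)" "a \<in> carrier A"
      by (auto simp: wreath_def)
    let ?v = "(shift A (inv\<^bsub>A\<^esub> a) (inv\<^bsub>base_group B A\<^esub> f), inv\<^bsub>A\<^esub> a)"
    have "?v \<in> carrier (B \<wr> A)" using u cl by (simp add: wreath_def)
    moreover have "?v \<otimes>\<^bsub>B \<wr> A\<^esub> u = \<one>\<^bsub>B \<wr> A\<^esub>"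
      using u by (simp add: wreath_def shift_mult[symmetric])
        (auto simp: shift_def one_base_group intro!: restrict_ext)
    ultimately show "\<exists>v\<in>carrier (B \<wr> A). v \<otimes>\<^bsub>B \<wr> A\<^esub> u = \<one>\<^bsub>B \<wr> A\<^esub>" by blast
  qed (auto simp: wreath_def cl shift_mult shift_shift shift_one F.m_assoc A.m_assoc)
qed


section \<open>The group of integer \<open>k\<close>-tuples\<close>

definition int_power :: "nat \<Rightarrow> (nat \<Rightarrow> int) monoid" where
  "int_power k = product_group {..<k} (\<lambda>_. integer_group)"

definition std_basis :: "nat \<Rightarrow> (nat \<Rightarrow> int) set" where
  "std_basis k = {(\<lambda>j\<in>{..<k}. if j = i then 1 else 0) | i. i < k}"

end

theory Submission
  imports Defs "HOL-Algebra.Multiplicative_Group"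
begin

text \<open>
Call \<open>g'\<close> a reversal of \<open>g\<close> if some word has value \<open>g\<close> and its reverse has value \<open>g'\<close>. Then
\<open>g p g'\<close> is a palindrome for every palindrome \<open>p\<close>. All five bounds come from this remark and from
the splitting of the wreath product as base group \<open>F\<close> times top group \<open>A\<close>. Commutators are
\<open>[a, b] = a b a\<^sup>-\<^sup>1 b\<^sup>-\<^sup>1\<close>.

\<^bold>\<open>The base group modulo its derived subgroup.\<close> The quotient \<open>F/[F, F]\<close> is abelian, so it is enough to
write it as a product of finitely many subgroups whose elements need boundedly many palindromes
modulo \<open>[F, F]\<close> (\<open>generate_pal_products_mod\<close>). If \<open>A\<close> is abelian and generated by \<open>T\<close>, the subgroups
\<open>{[h, t]. h \<in> F}\<close> for \<open>t \<in> T\<close> and \<open>\<langle>y\<rangle>\<close> for \<open>y \<in> Y\<close> do it: modulo the former, conjugation by \<open>t\<close> is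
trivial, so that only the coordinate at \<open>1\<close> is left. They cost three palindromes and one palindrome.
If \<open>A\<close> is finite, the cyclic groups generated by the conjugates of the generators \<open>y\<close> do it.

\<^bold>\<open>The derived subgroup when \<open>A\<close> is abelian and infinite.\<close> Some generator \<open>t\<close> has infinite order, and a
high power \<open>s\<close> of it displaces any given finite subset of \<open>F\<close>: the conjugates of this set by the powers
of \<open>s\<close> commute with one another. A product of \<open>m\<close> commutators can therefore be moved to \<open>m\<close> different
places at the cost of one factor \<open>[h, s]\<close>, and what results is one single commutator \<open>[U, V]\<close>,
whatever \<open>m\<close> is (\<open>list_prod_eq_commutator_spread\<close>, \<open>spread_commutators\<close>). Displacing the reversals of \<open>U\<close> and
\<open>V\<close> writes \<open>[U, V]\<close> with seven palindromes (\<open>commutator_pal_products\<close>). So \<open>[F, F]\<close> costs ten palindromes,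
and the wreath product costs \<open>|Y| + 4 |T| + 10\<close>, or \<open>|Y| + 4 |T|\<close> if \<open>[F, F]\<close> is trivial
(\<open>pw_abelian_top\<close>). Both bounds for abelian top groups follow by arithmetic.

\<^bold>\<open>The derived subgroup when \<open>A\<close> is not abelian.\<close> Take generators \<open>x\<close>, \<open>y\<close> of \<open>A\<close> that do not commute and
add \<open>c = x y\<close> as a generator. The word \<open>c y\<^sup>-\<^sup>1 x\<^sup>-\<^sup>1\<close> has value \<open>1\<close> but its reverse has not. So each
\<open>a \<in> A\<close> has two different reversals, and the conjugates of \<open>u\<close> and \<open>v\<close> by \<open>a\<close> have reversals that are
supported at different coordinates. These commute, hence \<open>1\<close> is a reversal of the conjugate of \<open>[u, v]\<close>,
and in the end of every element \<open>f\<close> of \<open>[F, F]\<close>; then \<open>f = f 1\<close> is a palindrome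
(\<open>base_derived_palindrome\<close>). So an element whose part in the base group lies in \<open>[F, F]\<close> needs at most one
palindrome more than its part in \<open>A\<close>, which for perfect groups is the case for all elements.
\<close>

section \<open>Words, their reversals, and palindromes\<close>

text \<open>With associativity and the rules for units and inverses, these two rules form a terminating and
  confluent rewrite system for free groups: simplification with \<open>word_simps\<close> decides whether two words
  have the same reduced form.\<close>

lemma (in group) inv_cancel_left:
  assumes "x \<in> carrier G" "y \<in> carrier G"
  shows "x \<otimes> (inv x \<otimes> y) = y" "inv x \<otimes> (x \<otimes> y) = y"
  using assms by (simp_all flip: m_assoc)

lemmas (in group) word_simps = m_assoc inv_mult_group inv_cancel_left

lemma (in monoid) list_prod_Nil [simp]: "list_prod G [] = \<one>"
  by (simp add: list_prod_def)

lemma (in monoid) list_prod_Cons [simp]: "list_prod G (x # xs) = x \<otimes> list_prod G xs"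
  by (simp add: list_prod_def)

lemma (in monoid) list_prod_closed [simp]: "set xs \<subseteq> carrier G \<Longrightarrow> list_prod G xs \<in> carrier G"
  by (induction xs) auto

lemma (in monoid) list_prod_append:
  "set xs \<subseteq> carrier G \<Longrightarrow> set ys \<subseteq> carrier G
    \<Longrightarrow> list_prod G (xs @ ys) = list_prod G xs \<otimes> list_prod G ys"
  by (induction xs) (auto simp: m_assoc)

lemma (in group) subgroup_list_prod:
  "subgroup H G \<Longrightarrow> set xs \<subseteq> H \<Longrightarrow> list_prod G xs \<in> H"
  by (induction xs) (auto intro: subgroup.one_closed subgroup.m_closed)

lemma products_le_mono:
  "S \<subseteq> S' \<Longrightarrow> M \<le> N \<Longrightarrow> products_le G S M \<subseteq> products_le G S' N"
  unfolding products_le_def using order_trans by blast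

lemma (in group) products_le_one: "\<one> \<in> products_le G S (enat n)"
  unfolding products_le_def by (auto intro!: exI[of _ "[]"] simp: zero_enat_def[symmetric])

lemma (in group) products_le_single:
  "s \<in> S \<Longrightarrow> S \<subseteq> carrier G \<Longrightarrow> s \<in> products_le G S (enat 1)"
  unfolding products_le_def by (auto intro!: exI[of _ "[s]"])

lemma (in group) products_le_mult:
  assumes "S \<subseteq> carrier G" "a \<in> products_le G S (enat m)" "b \<in> products_le G S (enat n)"
    and "m + n \<le> N"
  shows "a \<otimes> b \<in> products_le G S (enat N)"
proof -
  obtain xs ys where "a = list_prod G xs" "set xs \<subseteq> S" "length xs \<le> m"
      "b = list_prod G ys" "set ys \<subseteq> S" "length ys \<le> n"
    using assms(2,3) by (auto simp: products_le_def)
  then show ?thesis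
    unfolding products_le_def using assms(1,4)
    by (auto intro!: exI[of _ "xs @ ys"] simp: list_prod_append)
qed

lemma (in group) products_le_closed:
  "S \<subseteq> carrier G \<Longrightarrow> products_le G S N \<subseteq> carrier G"
  by (auto simp: products_le_def)

lemma width_attained:
  assumes "width G T S = enat N"
  shows "T \<subseteq> products_le G S (enat N)"
proof -
  let ?A = "{enat N | N. T \<subseteq> products_le G S (enat N)}"
  have "?A \<noteq> {}"
    using assms by (auto simp: width_def Inf_enat_def split: if_splits)
  then obtain M where "M \<in> ?A"
    by blast
  then have "Inf ?A \<in> ?A"
    by (rule wellorder_InfI)
  then show ?thesis
    using assms by (auto simp: width_def)
qed

lemma width_leI: "T \<subseteq> products_le G S (enat N) \<Longrightarrow> width G T S \<le> enat N"
  unfolding width_def by (rule Inf_lower) auto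

lemma word_value_Nil [simp]: "word_value G [] = \<one>\<^bsub>G\<^esub>"
  by (simp add: word_value_def list_prod_def)

lemma word_value_Cons [simp]:
  "word_value G ((x, e) # w) = x [^]\<^bsub>G\<^esub> e \<otimes>\<^bsub>G\<^esub> word_value G w"
  by (simp add: word_value_def list_prod_def)

lemma Nil_words [simp]: "[] \<in> words X"
  by (simp add: words_def)

lemma Cons_words [simp]: "(x, e) # w \<in> words X \<longleftrightarrow> x \<in> X \<and> e \<in> {1, -1} \<and> w \<in> words X"
  by (auto simp: words_def)

lemma append_words [simp]: "v @ w \<in> words X \<longleftrightarrow> v \<in> words X \<and> w \<in> words X"
  by (auto simp: words_def)

lemma rev_words [simp]: "rev w \<in> words X \<longleftrightarrow> w \<in> words X"
  by (auto simp: words_def)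

text \<open>A relation and not a function, since the value of the reversed word depends on the chosen word. The
  case of a non-abelian top group rests on elements with two different reversals.\<close>

definition is_reversal :: "('a, 'm) monoid_scheme \<Rightarrow> 'a set \<Rightarrow> 'a \<Rightarrow> 'a \<Rightarrow> bool" where
  "is_reversal G X g g' \<longleftrightarrow> (\<exists>w\<in>words X. word_value G w = g \<and> word_value G (rev w) = g')"

locale marked_group = group G for G (structure) +
  fixes X :: "'a set"
  assumes generating: "generates G X"
begin

lemma letter_closed [simp]: "x \<in> X \<Longrightarrow> x \<in> carrier G"
  using generating by (auto simp: generates_def)

lemma word_value_closed [simp]: "w \<in> words X \<Longrightarrow> word_value G w \<in> carrier G"
  by (induction w) auto

lemma word_value_append:
  "v \<in> words X \<Longrightarrow> w \<in> words X \<Longrightarrow> word_value G (v @ w) = word_value G v \<otimes> word_value G w"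
  by (induction v) (auto simp: m_assoc)

definition inverse_word :: "('a \<times> int) list \<Rightarrow> ('a \<times> int) list" where
  "inverse_word w = rev (map (\<lambda>(x, e). (x, - e)) w)"

lemma inverse_word_words: "w \<in> words X \<Longrightarrow> inverse_word w \<in> words X"
  by (induction w) (auto simp: inverse_word_def)

lemma rev_inverse_word: "rev (inverse_word w) = inverse_word (rev w)"
  by (simp add: inverse_word_def rev_map)

lemma word_value_inverse_word:
  "w \<in> words X \<Longrightarrow> word_value G (inverse_word w) = inv word_value G w"
proof (induction w)
  case (Cons a w)
  obtain x e where a: "a = (x, e)" by (cases a)
  have "inverse_word (a # w) = inverse_word w @ [(x, - e)]"
    by (simp add: inverse_word_def a)
  moreover have "(x, - e) # [] \<in> words X"
    using Cons.prems a by auto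
  ultimately show ?case
    using Cons a by (simp add: word_value_append inverse_word_words inv_mult_group int_pow_neg)
qed (simp add: inverse_word_def)

lemma reversal_closed:
  "is_reversal G X a a' \<Longrightarrow> a \<in> carrier G" "is_reversal G X a a' \<Longrightarrow> a' \<in> carrier G"
  by (auto simp: is_reversal_def)

lemma reversal_sym: "is_reversal G X a a' \<Longrightarrow> is_reversal G X a' a"
  unfolding is_reversal_def by (metis rev_rev_ident rev_words)

lemma reversal_one: "is_reversal G X \<one> \<one>"
  unfolding is_reversal_def by (rule bexI[of _ "[]"]) auto

lemma reversal_letter: "x \<in> X \<Longrightarrow> is_reversal G X x x"
  unfolding is_reversal_def by (rule bexI[of _ "[(x, 1)]"]) auto

lemma reversal_mult:
  assumes "is_reversal G X a a'" "is_reversal G X b b'"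
  shows "is_reversal G X (a \<otimes> b) (b' \<otimes> a')"
proof -
  obtain v w where "v \<in> words X" "word_value G v = a" "word_value G (rev v) = a'"
      "w \<in> words X" "word_value G w = b" "word_value G (rev w) = b'"
    using assms by (auto simp: is_reversal_def)
  then show ?thesis
    unfolding is_reversal_def
    by (intro bexI[of _ "v @ w"]) (auto simp: word_value_append)
qed

lemma reversal_inv:
  assumes "is_reversal G X a a'"
  shows "is_reversal G X (inv a) (inv a')"
proof -
  obtain v where "v \<in> words X" "word_value G v = a" "word_value G (rev v) = a'"
    using assms by (auto simp: is_reversal_def)
  then show ?thesis
    unfolding is_reversal_def
    by (intro bexI[of _ "inverse_word v"])
      (auto simp: word_value_inverse_word rev_inverse_word inverse_word_words)
qed

lemma reversal_generate:
  assumes "S \<subseteq> X" "g \<in> generate G S"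
  shows "\<exists>g'. is_reversal G X g g'"
  using assms(2)
proof induction
  case (eng a b)
  then show ?case using reversal_mult by blast
qed (use assms(1) in \<open>auto intro: reversal_one reversal_letter reversal_inv\<close>)

lemma reversal_exists:
  assumes "g \<in> carrier G"
  obtains g' where "is_reversal G X g g'"
  using reversal_generate[of X g] assms that generating by (auto simp: generates_def)

lemma palindromes_closed: "palindromes G X \<subseteq> carrier G"
  by (auto simp: palindromes_def)

lemma palindrome_closed [simp]: "p \<in> palindromes G X \<Longrightarrow> p \<in> carrier G"
  using palindromes_closed by blast

lemma palindrome_one: "\<one> \<in> palindromes G X"
  unfolding palindromes_def by (auto intro!: exI[of _ "[]"])

lemma palindrome_letter: "x \<in> X \<Longrightarrow> x \<in> palindromes G X"
  unfolding palindromes_def by (auto intro!: exI[of _ "[(x, 1)]"])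

lemma palindrome_inv:
  assumes "p \<in> palindromes G X"
  shows "inv p \<in> palindromes G X"
proof -
  obtain w where "p = word_value G w" "w \<in> words X" "rev w = w"
    using assms by (auto simp: palindromes_def)
  then show ?thesis
    unfolding palindromes_def
    by (auto intro!: exI[of _ "inverse_word w"]
        simp: word_value_inverse_word rev_inverse_word inverse_word_words)
qed

lemma palindrome_extend:
  assumes "is_reversal G X a a'" "p \<in> palindromes G X"
  shows "a \<otimes> p \<otimes> a' \<in> palindromes G X"
proof -
  obtain v w where "v \<in> words X" "word_value G v = a" "word_value G (rev v) = a'"
      "w \<in> words X" "word_value G w = p" "rev w = w"
    using assms by (auto simp: is_reversal_def palindromes_def)
  then show ?thesis
    unfolding palindromes_def
    by (auto intro!: exI[of _ "v @ w @ rev v"] simp: word_value_append m_assoc)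
qed

lemma palindrome_mult_reversal: "is_reversal G X a a' \<Longrightarrow> a \<otimes> a' \<in> palindromes G X"
  using palindrome_extend[OF _ palindrome_one] by (auto simp: reversal_closed)

lemma palindrome_nat_pow:
  assumes "x \<in> X"
  shows "x [^] (n::nat) \<in> palindromes G X"
proof -
  have "x [^] n = word_value G (replicate n (x, 1))"
  proof (induction n)
    case (Suc n)
    show ?case
      unfolding nat_pow_Suc2[OF letter_closed[OF assms]] using Suc assms by simp
  qed simp
  moreover have "replicate n (x, 1) \<in> words X"
    using assms by (induction n) auto
  ultimately show ?thesis
    unfolding palindromes_def by (auto intro!: exI[of _ "replicate n (x, 1)"])
qed

lemma palindrome_int_pow:
  "x \<in> X \<Longrightarrow> x [^] (n::int) \<in> palindromes G X"
  by (cases n rule: int_cases2)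
    (auto simp: int_pow_int int_pow_neg_int palindrome_nat_pow intro: palindrome_inv)

lemma palindromes_one: "p \<in> palindromes G X \<Longrightarrow> p \<in> products_le G (palindromes G X) (enat 1)"
  by (rule products_le_single[OF _ palindromes_closed])

lemmas palindromes_mult = products_le_mult[OF palindromes_closed]

text \<open>In \<open>h p h\<^sup>-\<^sup>1 p\<^sup>-\<^sup>1 = (h p h') (h'\<^sup>-\<^sup>1 h\<^sup>-\<^sup>1) p\<^sup>-\<^sup>1\<close> the middle factor is a palindrome too, because \<open>h\<^sup>-\<^sup>1\<close> is
  a reversal of \<open>h'\<^sup>-\<^sup>1\<close>.\<close>

lemma commutator_palindrome:
  assumes "h \<in> carrier G" "p \<in> palindromes G X"
  shows "h \<otimes> p \<otimes> inv h \<otimes> inv p \<in> products_le G (palindromes G X) (enat 3)"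
proof -
  obtain h' where h': "is_reversal G X h h'" using reversal_exists assms(1) .
  note [simp] = assms(1) assms(2)[THEN palindrome_closed] reversal_closed[OF h']
  have "h \<otimes> p \<otimes> h' \<in> palindromes G X" "inv h' \<otimes> inv h \<in> palindromes G X"
    using palindrome_extend[OF h' assms(2)] palindrome_mult_reversal[OF reversal_inv[OF reversal_sym[OF h']]]
    by auto
  then have "(h \<otimes> p \<otimes> h') \<otimes> ((inv h' \<otimes> inv h) \<otimes> inv p) \<in> products_le G (palindromes G X) (enat 3)"
    by (intro palindromes_mult[where m=1 and n=2] palindromes_mult[where m=1 and n=1] palindromes_one
        palindrome_inv assms(2)) auto
  then show ?thesis by (simp add: word_simps)
qed

end

lemma is_reversal_hom:
  assumes "marked_group H Z" "marked_group G X" "\<phi> \<in> hom H G" "\<phi> ` Z \<subseteq> X"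
  shows "is_reversal H Z a a' \<Longrightarrow> is_reversal G X (\<phi> a) (\<phi> a')"
    and "p \<in> palindromes H Z \<Longrightarrow> \<phi> p \<in> palindromes G X"
proof -
  interpret H: marked_group H Z by fact
  interpret G: marked_group G X by fact
  interpret group_hom H G \<phi> using assms(3) by unfold_locales
  let ?m = "map (\<lambda>(x, e). (\<phi> x, e))"
  have m: "?m w \<in> words X \<and> word_value G (?m w) = \<phi> (word_value H w)" if "w \<in> words Z" for w
    using that by (induction w) (use assms(4) in \<open>auto simp: hom_int_pow image_subset_iff\<close>)
  show "is_reversal G X (\<phi> a) (\<phi> a')" if rev: "is_reversal H Z a a'"
  proof -
    obtain w where "w \<in> words Z" "a = word_value H w" "a' = word_value H (rev w)"
      using rev unfolding is_reversal_def by blast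
    then show ?thesis
      unfolding is_reversal_def using m[of w] m[of "rev w"]
      by (intro bexI[of _ "?m w"]) (auto simp: rev_map)
  qed
  show "\<phi> p \<in> palindromes G X" if pal: "p \<in> palindromes H Z"
  proof -
    obtain w where "p = word_value H w" "w \<in> words Z" "rev w = w"
      using pal unfolding palindromes_def by blast
    then show ?thesis
      unfolding palindromes_def using m by (auto intro!: exI[of _ "?m w"] simp: rev_map)
  qed
qed

section \<open>Subgroups of bounded palindromic width modulo commutators\<close>

lemma set_multI: "h \<in> H \<Longrightarrow> k \<in> K \<Longrightarrow> x = h \<otimes>\<^bsub>G\<^esub> k \<Longrightarrow> x \<in> H <#>\<^bsub>G\<^esub> K"
  by (auto simp: set_mult_def)

lemma (in group) subgroup_set_mult:
  assumes N: "subgroup N G" and M: "subgroup M G"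
    and norm: "\<And>m a. m \<in> M \<Longrightarrow> a \<in> N \<Longrightarrow> m \<otimes> a \<otimes> inv m \<in> N"
  shows "subgroup (N <#> M) G"
proof
  note [simp] = subgroup.mem_carrier[OF N] subgroup.mem_carrier[OF M]
  show "N <#> M \<subseteq> carrier G"
    by (auto simp: set_mult_def)
  show "\<one> \<in> N <#> M"
    by (intro set_multI[of \<one> _ \<one>] subgroup.one_closed[OF N] subgroup.one_closed[OF M]) simp
  fix x assume "x \<in> N <#> M"
  then obtain a m where x: "x = a \<otimes> m" "a \<in> N" "m \<in> M"
    by (auto simp: set_mult_def)
  have "inv x = (inv m \<otimes> inv a \<otimes> inv (inv m)) \<otimes> inv m"
    using x by (simp add: word_simps)
  moreover have "inv m \<otimes> inv a \<otimes> inv (inv m) \<in> N" "inv m \<in> M"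
    using x N M by (intro norm subgroup.m_inv_closed; simp)+
  ultimately show "inv x \<in> N <#> M"
    unfolding set_mult_def by blast
  fix y assume "y \<in> N <#> M"
  then obtain b l where y: "y = b \<otimes> l" "b \<in> N" "l \<in> M"
    by (auto simp: set_mult_def)
  have "x \<otimes> y = (a \<otimes> (m \<otimes> b \<otimes> inv m)) \<otimes> (m \<otimes> l)"
    using x y by (simp add: word_simps)
  moreover have "a \<otimes> (m \<otimes> b \<otimes> inv m) \<in> N" "m \<otimes> l \<in> M"
    using x y N M by (auto intro!: norm subgroup.m_closed)
  ultimately show "x \<otimes> y \<in> N <#> M"
    unfolding set_mult_def by blast
qed

context marked_group
begin

abbreviation pal_products :: "nat \<Rightarrow> 'a set" where
  "pal_products n \<equiv> products_le G (palindromes G X) (enat n)"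

lemma pal_products_closed [simp]: "a \<in> pal_products n \<Longrightarrow> a \<in> carrier G"
  using products_le_closed[OF palindromes_closed] by blast

text \<open>The factor of \<open>D\<close> in the middle moves to the right end, since \<open>D\<close> is normal.\<close>

lemma pal_products_mod_mult:
  assumes D: "D \<lhd> G" and a: "a \<in> pal_products m <#> D" and b: "b \<in> pal_products n <#> D"
  shows "a \<otimes> b \<in> pal_products (m + n) <#> D"
proof -
  interpret D: normal D G by fact
  obtain p d q e where pq: "a = p \<otimes> d" "b = q \<otimes> e" "p \<in> pal_products m" "q \<in> pal_products n"
      "d \<in> D" "e \<in> D"
    using a b by (auto simp: set_mult_def)
  have "a \<otimes> b = (p \<otimes> q) \<otimes> ((inv q \<otimes> d \<otimes> q) \<otimes> e)"
    using pq by (simp add: word_simps)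
  moreover have "p \<otimes> q \<in> pal_products (m + n)"
    using pq by (auto intro: palindromes_mult)
  moreover have "(inv q \<otimes> d \<otimes> q) \<otimes> e \<in> D"
    using pq by (intro D.m_closed D.inv_op_closed1) auto
  ultimately show ?thesis
    unfolding set_mult_def by blast
qed

text \<open>Modulo \<open>D\<close> the subgroups \<open>N i\<close> commute with one another, so the subgroup that they generate is
  their product in any order, and the numbers of palindromes add up.\<close>

lemma generate_pal_products_mod:
  assumes F: "subgroup F G" and D: "D \<lhd> G" and comm: "\<And>a b. a \<in> F \<Longrightarrow> b \<in> F \<Longrightarrow> a \<otimes> b \<otimes> inv a \<otimes> inv b \<in> D" and "finite I"
    and N: "\<And>i. i \<in> I \<Longrightarrow> subgroup (N i) G" "\<And>i. i \<in> I \<Longrightarrow> D \<subseteq> N i" "\<And>i. i \<in> I \<Longrightarrow> N i \<subseteq> F"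
    and pal: "\<And>i. i \<in> I \<Longrightarrow> N i \<subseteq> pal_products (n i) <#> D"
  shows "generate G (\<Union>i\<in>I. N i) \<subseteq> pal_products (\<Sum>i\<in>I. n i) <#> D"
  using \<open>finite I\<close> N pal
proof (induction I)
  case empty
  interpret D: normal D G by fact
  have "\<one> \<in> pal_products 0 <#> D"
    by (intro set_multI[of \<one> _ \<one>] products_le_one D.one_closed) simp
  then show ?case
    by (simp add: generate_empty)
next
  case (insert i I)
  let ?M = "generate G (\<Union>i\<in>I. N i)"
  note FG = subgroup.mem_carrier[OF F]
  have MF: "?M \<subseteq> F"
    using insert.prems(3) by (intro generate_subgroup_incl F) blast
  have M: "subgroup ?M G"
    using insert.prems(3) subgroup.subset[OF F] by (intro generate_is_subgroup) blast
  have "m \<otimes> a \<otimes> inv m \<in> N i" if m: "m \<in> ?M" and a: "a \<in> N i" for m a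
  proof -
    have "m \<in> F" "a \<in> F"
      using m a MF insert.prems(3)[of i] by auto
    then have "m \<otimes> a \<otimes> inv m \<otimes> inv a \<in> D"
      by (intro comm)
    then have "m \<otimes> a \<otimes> inv m \<otimes> inv a \<in> N i"
      using insert.prems(2)[of i] by auto
    then have "(m \<otimes> a \<otimes> inv m \<otimes> inv a) \<otimes> a \<in> N i"
      using a insert.prems(1) by (auto intro: subgroup.m_closed)
    then show ?thesis
      using FG \<open>m \<in> F\<close> \<open>a \<in> F\<close> by (simp add: word_simps)
  qed
  then have "subgroup (N i <#> ?M) G"
    using insert.prems M by (intro subgroup_set_mult) auto
  moreover have "N i \<subseteq> N i <#> ?M"
  proof
    fix a assume "a \<in> N i"
    then have "a = a \<otimes> \<one>" "\<one> \<in> ?M"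
      using insert.prems(3)[of i] FG by (auto intro: generate.one)
    then show "a \<in> N i <#> ?M"
      using \<open>a \<in> N i\<close> unfolding set_mult_def by blast
  qed
  moreover have "?M \<subseteq> N i <#> ?M"
  proof
    fix a assume "a \<in> ?M"
    then have "a = \<one> \<otimes> a" "\<one> \<in> N i"
      using insert.prems FG MF by (auto intro: subgroup.one_closed)
    then show "a \<in> N i <#> ?M"
      using \<open>a \<in> ?M\<close> unfolding set_mult_def by blast
  qed
  ultimately have "generate G (\<Union>i\<in>insert i I. N i) \<subseteq> N i <#> ?M"
    using generate.incl[of _ "\<Union>i\<in>I. N i" G] by (intro generate_subgroup_incl) auto
  also have "N i <#> ?M \<subseteq> pal_products (n i + (\<Sum>i\<in>I. n i)) <#> D"
  proof
    fix x assume "x \<in> N i <#> ?M"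
    then obtain a m where x: "x = a \<otimes> m" "a \<in> N i" "m \<in> ?M"
      by (auto simp: set_mult_def)
    have "?M \<subseteq> pal_products (\<Sum>i\<in>I. n i) <#> D"
      using insert.prems by (intro insert.IH) auto
    then show "x \<in> pal_products (n i + (\<Sum>i\<in>I. n i)) <#> D"
      unfolding x(1) using x insert.prems(4)[of i] by (intro pal_products_mod_mult[OF D]) auto
  qed
  finally show ?case
    using insert.hyps by simp
qed

lemma cyclic_piece:
  assumes D: "D \<lhd> G" and F: "subgroup F G" and DF: "D \<subseteq> F" and p: "p \<in> F"
    and pal: "\<And>n::int. p [^] n \<in> pal_products k"
  defines "N \<equiv> D <#> generate G {p}"
  shows "subgroup N G" "D \<subseteq> N" "N \<subseteq> F" "p \<in> N" "N \<subseteq> pal_products k <#> D"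
proof -
  interpret D: normal D G by fact
  have pG: "p \<in> carrier G"
    using p subgroup.subset[OF F] by blast
  have P: "subgroup (generate G {p}) G"
    using pG by (intro generate_is_subgroup) auto
  note pow = generate_pow[OF pG]
  show "subgroup N G"
    unfolding N_def using D.inv_op_closed2 subgroup.mem_carrier[OF P]
    by (intro subgroup_set_mult P D.is_subgroup) auto
  have 1: "\<one> \<in> generate G {p}" "p \<in> generate G {p}"
    by (auto intro: generate.intros)
  show "D \<subseteq> N"
  proof
    fix d assume "d \<in> D"
    then have "d = d \<otimes> \<one>" by simp
    then show "d \<in> N" unfolding N_def set_mult_def using \<open>d \<in> D\<close> 1 by blast
  qed
  show "p \<in> N"
  proof -
    have "p = \<one> \<otimes> p" using pG by simp
    then show ?thesis unfolding N_def set_mult_def using D.one_closed 1 by blast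
  qed
  show "N \<subseteq> F"
    unfolding N_def set_mult_def using DF generate_subgroup_incl[of "{p}" F, OF _ F] p
    by (fastforce intro: subgroup.m_closed[OF F])
  show "N \<subseteq> pal_products k <#> D"
  proof
    fix x assume "x \<in> N"
    then obtain d and n :: int where x: "x = d \<otimes> p [^] n" "d \<in> D"
      by (auto simp: N_def set_mult_def pow)
    then have "x = p [^] n \<otimes> (inv (p [^] n) \<otimes> d \<otimes> p [^] n)"
      using pG by (simp add: word_simps)
    moreover have "inv (p [^] n) \<otimes> d \<otimes> p [^] n \<in> D"
      using x pG by (auto intro: D.inv_op_closed1)
    ultimately show "x \<in> pal_products k <#> D"
      unfolding set_mult_def using pal by blast
  qed
qed

text \<open>Modulo \<open>D\<close> the group \<open>F\<close> is abelian, so \<open>h \<mapsto> [h, t]\<close> is a homomorphism on it. This is why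
  the commutators with one letter \<open>t\<close>, at three palindromes each, form a subgroup modulo \<open>D\<close>.\<close>

lemma commutator_piece:
  assumes D: "D \<lhd> G" and F: "F \<lhd> G" and DF: "D \<subseteq> F" and comm: "\<And>a b. a \<in> F \<Longrightarrow> b \<in> F \<Longrightarrow> a \<otimes> b \<otimes> inv a \<otimes> inv b \<in> D" and t: "t \<in> X"
  defines "N \<equiv> (\<lambda>h. h \<otimes> t \<otimes> inv h \<otimes> inv t) ` F <#> D"
  shows "subgroup N G" "D \<subseteq> N" "N \<subseteq> F" "h \<in> F \<Longrightarrow> h \<otimes> t \<otimes> inv h \<otimes> inv t \<in> N"
    "N \<subseteq> pal_products 3 <#> D"
proof -
  interpret D: normal D G by fact
  interpret F: normal F G by fact
  let ?c = "\<lambda>h. h \<otimes> t \<otimes> inv h \<otimes> inv t"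
  have [simp]: "t \<in> carrier G" using t by simp
  have cF: "?c h \<in> F" if "h \<in> F" for h
  proof -
    have "?c h = h \<otimes> (t \<otimes> inv h \<otimes> inv t)"
      using that by (simp add: word_simps)
    then show ?thesis
      using that by (auto intro!: F.m_closed F.inv_op_closed2)
  qed
  show "D \<subseteq> N"
  proof
    fix d assume "d \<in> D"
    then have "d = ?c \<one> \<otimes> d" by simp
    then show "d \<in> N" unfolding N_def set_mult_def using \<open>d \<in> D\<close> F.one_closed by blast
  qed
  show "N \<subseteq> F"
  proof
    fix a assume "a \<in> N"
    then obtain h d where "a = ?c h \<otimes> d" "h \<in> F" "d \<in> D"
      by (auto simp: N_def set_mult_def)
    then show "a \<in> F"
      using cF[of h] DF F.m_closed[of "?c h" d] by blast
  qed
  show cN: "?c h \<in> N" if "h \<in> F" for h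
  proof -
    have "?c h = ?c h \<otimes> \<one>" using that by simp
    then show ?thesis unfolding N_def set_mult_def using that D.one_closed by blast
  qed
  show "N \<subseteq> pal_products 3 <#> D"
    unfolding N_def
    using commutator_palindrome[OF _ palindrome_letter[OF t]] F.subset by (intro mono_set_mult) auto
  show "subgroup N G"
  proof
    show "N \<subseteq> carrier G"
      using \<open>N \<subseteq> F\<close> F.subset by blast
    show "\<one> \<in> N"
      using \<open>D \<subseteq> N\<close> D.one_closed by blast
    fix a assume "a \<in> N"
    then obtain h d where a: "a = ?c h \<otimes> d" "h \<in> F" "d \<in> D"
      by (auto simp: N_def set_mult_def)
    define x where "x = ?c h"
    have x: "x \<in> F" using a cF by (simp add: x_def)
    define w where "w = ?c (inv h)"
    have w: "w \<in> F" using a cF[of "inv h"] by (simp add: w_def)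
    \<comment> \<open>The inverse of \<open>[h, t]\<close> is a conjugate of \<open>[h\<^sup>-\<^sup>1, t]\<close> by an element of \<open>F\<close>, hence equal to it modulo \<open>D\<close>.\<close>
    have "inv x = h \<otimes> w \<otimes> inv h"
      using a by (simp add: x_def w_def word_simps)
    then have "w \<otimes> ((inv w \<otimes> h \<otimes> inv (inv w) \<otimes> inv h) \<otimes> (x \<otimes> inv d \<otimes> inv x)) = inv x \<otimes> (x \<otimes> inv d \<otimes> inv x)"
      using a w x by (simp add: word_simps)
    also have "\<dots> = inv a"
      using a x unfolding x_def[symmetric] by (simp add: word_simps)
    finally have "inv a = w \<otimes> ((inv w \<otimes> h \<otimes> inv (inv w) \<otimes> inv h) \<otimes> (x \<otimes> inv d \<otimes> inv x))" ..
    moreover have "(inv w \<otimes> h \<otimes> inv (inv w) \<otimes> inv h) \<otimes> (x \<otimes> inv d \<otimes> inv x) \<in> D"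
      using a w x by (intro D.m_closed comm D.inv_op_closed2) auto
    ultimately show "inv a \<in> N"
      unfolding N_def set_mult_def w_def using a F.m_inv_closed by blast
    fix b assume "b \<in> N"
    then obtain k e where b: "b = ?c k \<otimes> e" "k \<in> F" "e \<in> D"
      by (auto simp: N_def set_mult_def)
    define y where "y = ?c k"
    have y: "y \<in> F" using b cF by (simp add: y_def)
    \<comment> \<open>The right side is \<open>x y\<close> modulo \<open>D\<close>.\<close>
    have "?c (h \<otimes> k) = h \<otimes> y \<otimes> inv h \<otimes> x"
      using a b by (simp add: x_def y_def word_simps)
    then have "a \<otimes> b = ?c (h \<otimes> k) \<otimes> ((inv x \<otimes> (h \<otimes> inv y \<otimes> inv h \<otimes> inv (inv y)) \<otimes> x)
        \<otimes> ((inv x \<otimes> inv y \<otimes> inv (inv x) \<otimes> inv (inv y)) \<otimes> ((inv y \<otimes> d \<otimes> y) \<otimes> e)))"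
      using a b x y unfolding a(1) b(1) x_def[symmetric] y_def[symmetric] by (simp add: word_simps)
    moreover have "(inv x \<otimes> (h \<otimes> inv y \<otimes> inv h \<otimes> inv (inv y)) \<otimes> x)
        \<otimes> ((inv x \<otimes> inv y \<otimes> inv (inv x) \<otimes> inv (inv y)) \<otimes> ((inv y \<otimes> d \<otimes> y) \<otimes> e)) \<in> D"
      using a b x y by (intro D.m_closed comm D.inv_op_closed1) auto
    ultimately show "a \<otimes> b \<in> N"
      unfolding N_def set_mult_def using a b F.m_closed by blast
  qed
qed

end

section \<open>Commutators of displaced elements\<close>

context group
begin

lemma commute_inv:
  assumes "a \<in> carrier G" "b \<in> carrier G" "a \<otimes> b = b \<otimes> a"
  shows "inv b \<otimes> a = a \<otimes> inv b"
  using assms by (metis inv_closed inv_solve_left' inv_solve_right m_assoc m_closed)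

lemma subgroup_centralizer:
  assumes "x \<in> carrier G"
  shows "subgroup {g \<in> carrier G. x \<otimes> g = g \<otimes> x} G"
proof
  fix g assume g: "g \<in> {g \<in> carrier G. x \<otimes> g = g \<otimes> x}"
  then show "inv g \<in> {g \<in> carrier G. x \<otimes> g = g \<otimes> x}"
    using assms commute_inv[of x g] by auto
  fix h assume h: "h \<in> {g \<in> carrier G. x \<otimes> g = g \<otimes> x}"
  have gh: "g \<in> carrier G" "h \<in> carrier G" "x \<otimes> g = g \<otimes> x" "x \<otimes> h = h \<otimes> x"
    using g h by auto
  have "x \<otimes> (g \<otimes> h) = (x \<otimes> g) \<otimes> h"
    using gh(1,2) assms by (simp add: m_assoc)
  also have "\<dots> = g \<otimes> (x \<otimes> h)"
    unfolding gh(3) using gh(1,2) assms by (simp add: m_assoc)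
  also have "\<dots> = (g \<otimes> h) \<otimes> x"
    unfolding gh(4) using gh(1,2) assms by (simp add: m_assoc)
  finally show "g \<otimes> h \<in> {g \<in> carrier G. x \<otimes> g = g \<otimes> x}"
    using gh by simp
qed (use assms in auto)

text \<open>Together with \<open>word_simps\<close> these rules move \<open>a\<close> to the left of \<open>b\<close> in every word.\<close>

lemma commute_simps:
  assumes "a \<in> carrier G" "b \<in> carrier G" "a \<otimes> b = b \<otimes> a"
  shows "b \<otimes> a = a \<otimes> b" "inv b \<otimes> a = a \<otimes> inv b"
    "b \<otimes> inv a = inv a \<otimes> b" "inv b \<otimes> inv a = inv a \<otimes> inv b"
    "y \<in> carrier G \<Longrightarrow> b \<otimes> (a \<otimes> y) = a \<otimes> (b \<otimes> y)"
    "y \<in> carrier G \<Longrightarrow> inv b \<otimes> (a \<otimes> y) = a \<otimes> (inv b \<otimes> y)"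
    "y \<in> carrier G \<Longrightarrow> b \<otimes> (inv a \<otimes> y) = inv a \<otimes> (b \<otimes> y)"
    "y \<in> carrier G \<Longrightarrow> inv b \<otimes> (inv a \<otimes> y) = inv a \<otimes> (inv b \<otimes> y)"
proof -
  have 1: "inv b \<otimes> a = a \<otimes> inv b" using commute_inv assms .
  have 2: "b \<otimes> inv a = inv a \<otimes> b" using commute_inv[of b a] assms by simp
  have 3: "inv b \<otimes> inv a = inv a \<otimes> inv b" using commute_inv[of "inv a" b] assms 2 by simp
  show "b \<otimes> a = a \<otimes> b" "inv b \<otimes> a = a \<otimes> inv b"
    "b \<otimes> inv a = inv a \<otimes> b" "inv b \<otimes> inv a = inv a \<otimes> inv b"
    using assms 1 2 3 by simp_all
  show "y \<in> carrier G \<Longrightarrow> b \<otimes> (a \<otimes> y) = a \<otimes> (b \<otimes> y)"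
    using assms by (metis m_assoc)
  show "y \<in> carrier G \<Longrightarrow> inv b \<otimes> (a \<otimes> y) = a \<otimes> (inv b \<otimes> y)"
    using assms 1 by (metis m_assoc inv_closed)
  show "y \<in> carrier G \<Longrightarrow> b \<otimes> (inv a \<otimes> y) = inv a \<otimes> (b \<otimes> y)"
    using assms 2 by (metis m_assoc inv_closed)
  show "y \<in> carrier G \<Longrightarrow> inv b \<otimes> (inv a \<otimes> y) = inv a \<otimes> (inv b \<otimes> y)"
    using assms 3 by (metis m_assoc inv_closed)
qed

lemma commutator_mult:
  assumes "u \<in> carrier G" "v \<in> carrier G" "U \<in> carrier G" "V \<in> carrier G"
    and "u \<otimes> U = U \<otimes> u" "u \<otimes> V = V \<otimes> u" "v \<otimes> U = U \<otimes> v" "v \<otimes> V = V \<otimes> v"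
  shows "(u \<otimes> U) \<otimes> (v \<otimes> V) \<otimes> inv (u \<otimes> U) \<otimes> inv (v \<otimes> V)
    = (u \<otimes> v \<otimes> inv u \<otimes> inv v) \<otimes> (U \<otimes> V \<otimes> inv U \<otimes> inv V)"
  using assms(1-4) commute_simps[OF assms(1,3,5)] commute_simps[OF assms(1,4,6)]
    commute_simps[OF assms(2,3,7)] commute_simps[OF assms(2,4,8)]
  by (simp add: word_simps)

text \<open>The product \<open>(s c\<^sub>1 s\<^sup>-\<^sup>1) (s\<^sup>2 c\<^sub>2 s\<^sup>-\<^sup>2) \<dots>\<close>.\<close>

primrec spread :: "'a \<Rightarrow> 'a list \<Rightarrow> 'a" where
  "spread s [] = \<one>"
| "spread s (c # cs) = s \<otimes> (c \<otimes> spread s cs) \<otimes> inv s"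

lemma spread_closed [simp]:
  "s \<in> carrier G \<Longrightarrow> set cs \<subseteq> carrier G \<Longrightarrow> spread s cs \<in> carrier G"
  by (induction cs) auto

text \<open>Since \<open>S\<close> is compared with all its conjugates by positive powers of \<open>s\<close>, the conjugates of \<open>S\<close> by
  distinct powers of \<open>s\<close> commute pairwise.\<close>

definition displaces :: "'a \<Rightarrow> 'a set \<Rightarrow> bool" where
  "displaces s S \<longleftrightarrow> (\<forall>x\<in>S. \<forall>y\<in>S. \<forall>j::nat. j > 0 \<longrightarrow>
     x \<otimes> (s [^] j \<otimes> y \<otimes> inv (s [^] j)) = (s [^] j \<otimes> y \<otimes> inv (s [^] j)) \<otimes> x)"

text \<open>Centralizers are subgroups, first in one argument of the commutation and then in the other.\<close>

lemma displaces_generate: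
  assumes s: "s \<in> carrier G" and S: "displaces s S" "S \<subseteq> carrier G"
  shows "displaces s (generate G S)"
  unfolding displaces_def
proof (intro ballI allI impI)
  fix x y and j :: nat assume x: "x \<in> generate G S" and y: "y \<in> generate G S" and j: "j > 0"
  define r where "r = s [^] j"
  have [simp]: "r \<in> carrier G" using s by (simp add: r_def)
  have d: "a \<otimes> (r \<otimes> b \<otimes> inv r) = (r \<otimes> b \<otimes> inv r) \<otimes> a" if "a \<in> S" "b \<in> S" for a b
    using S(1) j that unfolding displaces_def r_def by blast
  have C: "generate G S \<subseteq> {g \<in> carrier G. c \<otimes> g = g \<otimes> c}"
    if "c \<in> carrier G" "\<And>a. a \<in> S \<Longrightarrow> c \<otimes> a = a \<otimes> c" for c
    using that S(2) by (intro generate_subgroup_incl subgroup_centralizer) auto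
  have [simp]: "x \<in> carrier G" "y \<in> carrier G"
    using x y generate_in_carrier[OF S(2)] by auto
  have flip: "(inv r \<otimes> a \<otimes> r) \<otimes> b = b \<otimes> (inv r \<otimes> a \<otimes> r)
      \<longleftrightarrow> a \<otimes> (r \<otimes> b \<otimes> inv r) = (r \<otimes> b \<otimes> inv r) \<otimes> a"
    if [simp]: "a \<in> carrier G" "b \<in> carrier G" for a b
  proof
    assume "(inv r \<otimes> a \<otimes> r) \<otimes> b = b \<otimes> (inv r \<otimes> a \<otimes> r)"
    then have "r \<otimes> ((inv r \<otimes> a \<otimes> r) \<otimes> b) \<otimes> inv r = r \<otimes> (b \<otimes> (inv r \<otimes> a \<otimes> r)) \<otimes> inv r" by simp
    then show "a \<otimes> (r \<otimes> b \<otimes> inv r) = (r \<otimes> b \<otimes> inv r) \<otimes> a" by (simp add: word_simps)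
  next
    assume "a \<otimes> (r \<otimes> b \<otimes> inv r) = (r \<otimes> b \<otimes> inv r) \<otimes> a"
    then have "inv r \<otimes> (a \<otimes> (r \<otimes> b \<otimes> inv r)) \<otimes> r = inv r \<otimes> ((r \<otimes> b \<otimes> inv r) \<otimes> a) \<otimes> r" by simp
    then show "(inv r \<otimes> a \<otimes> r) \<otimes> b = b \<otimes> (inv r \<otimes> a \<otimes> r)" by (simp add: word_simps)
  qed
  have xy: "a \<otimes> (r \<otimes> y \<otimes> inv r) = (r \<otimes> y \<otimes> inv r) \<otimes> a" if a: "a \<in> S" for a
  proof -
    have "a \<in> carrier G" using a S(2) by blast
    then have "(inv r \<otimes> a \<otimes> r) \<otimes> y = y \<otimes> (inv r \<otimes> a \<otimes> r)"
    proof -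
      have "(inv r \<otimes> a \<otimes> r) \<otimes> b = b \<otimes> (inv r \<otimes> a \<otimes> r)" if "b \<in> S" for b
        using flip[of a b] d[OF a that] \<open>a \<in> carrier G\<close> S(2) that by blast
      then have "generate G S \<subseteq> {g \<in> carrier G. (inv r \<otimes> a \<otimes> r) \<otimes> g = g \<otimes> (inv r \<otimes> a \<otimes> r)}"
        using \<open>a \<in> carrier G\<close> by (intro C) simp_all
      then show ?thesis using y by blast
    qed
    then show ?thesis using flip \<open>a \<in> carrier G\<close> by simp
  qed
  have "generate G S \<subseteq> {g \<in> carrier G. (r \<otimes> y \<otimes> inv r) \<otimes> g = g \<otimes> (r \<otimes> y \<otimes> inv r)}"
    by (intro C xy[symmetric]) simp_all
  then have "(r \<otimes> y \<otimes> inv r) \<otimes> x = x \<otimes> (r \<otimes> y \<otimes> inv r)"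
    using x by blast
  then show "x \<otimes> (s [^] j \<otimes> y \<otimes> inv (s [^] j)) = s [^] j \<otimes> y \<otimes> inv (s [^] j) \<otimes> x"
    by (simp add: r_def)
qed

lemma displaces_commute_spread:
  assumes s: "s \<in> carrier G" and S: "displaces s S" "S \<subseteq> carrier G" and x: "x \<in> S" and cs: "set cs \<subseteq> S"
  shows "x \<otimes> (s [^] (k::nat) \<otimes> spread s cs \<otimes> inv (s [^] k))
    = (s [^] k \<otimes> spread s cs \<otimes> inv (s [^] k)) \<otimes> x"
  using cs
proof (induction cs arbitrary: k)
  case Nil
  then show ?case using s x S by auto
next
  case (Cons c cs)
  have [simp]: "x \<in> carrier G" "c \<in> carrier G" "set cs \<subseteq> carrier G"
    using Cons.prems x S by auto
  note [simp] = s
  let ?a = "s [^] Suc k \<otimes> c \<otimes> inv (s [^] Suc k)"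
  let ?b = "s [^] Suc k \<otimes> spread s cs \<otimes> inv (s [^] Suc k)"
  have eq: "s [^] k \<otimes> spread s (c # cs) \<otimes> inv (s [^] k) = ?a \<otimes> ?b"
    by (simp add: word_simps)
  have a: "x \<otimes> ?a = ?a \<otimes> x"
    using S(1) x Cons.prems unfolding displaces_def
    by (metis insert_subset list.simps(15) zero_less_Suc)
  have b: "x \<otimes> ?b = ?b \<otimes> x"
    using Cons.IH[of "Suc k"] Cons.prems by (simp del: nat_pow_Suc)
  have ab: "?a \<in> carrier G" "?b \<in> carrier G"
    by (simp_all del: nat_pow_Suc)
  have "x \<otimes> (?a \<otimes> ?b) = ?a \<otimes> (x \<otimes> ?b)"
    using ab a by (metis m_assoc \<open>x \<in> carrier G\<close>)
  also have "\<dots> = (?a \<otimes> ?b) \<otimes> x"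
    using ab b by (metis m_assoc \<open>x \<in> carrier G\<close>)
  finally show ?case unfolding eq .
qed

text \<open>If \<open>P\<^sub>j\<close> is the product of the factors from the \<open>j\<close>-th on, then \<open>h\<close> is the product of the \<open>P\<^sub>1\<close>,
  \<open>s P\<^sub>2 s\<^sup>-\<^sup>1\<close>, \<open>s\<^sup>2 P\<^sub>3 s\<^sup>-\<^sup>2\<close>, and so on. In \<open>[h, s] = h (s h s\<^sup>-\<^sup>1)\<^sup>-\<^sup>1\<close> the place \<open>j > 0\<close> receives
  \<open>P\<^bsub>j+1\<^esub> P\<^sub>j\<^sup>-\<^sup>1\<close>, which is the inverse of the \<open>j\<close>-th factor, and the place \<open>0\<close> receives the whole product.\<close>

lemma list_prod_eq_commutator_spread:
  assumes s: "s \<in> carrier G" and dS: "displaces s S" and S: "subgroup S G" and "set cs \<subseteq> S"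
  shows "\<exists>h\<in>carrier G. list_prod G cs = (h \<otimes> s \<otimes> inv h \<otimes> inv s) \<otimes> spread s cs"
  using assms(4)
proof (induction cs)
  case Nil
  then show ?case using s by (intro bexI[of _ \<one>]) auto
next
  case (Cons c cs)
  interpret S: subgroup S G by (rule S)
  obtain h where h: "h \<in> carrier G"
      "list_prod G cs = (h \<otimes> s \<otimes> inv h \<otimes> inv s) \<otimes> spread s cs"
    using Cons by auto
  define P where "P = list_prod G cs"
  define E where "E = spread s cs"
  have PS: "P \<in> S" using Cons.prems subgroup_list_prod[OF S] by (auto simp: P_def)
  have [simp]: "c \<in> carrier G" "set cs \<subseteq> carrier G" "P \<in> carrier G" "E \<in> carrier G"
    using Cons.prems S.subset s PS by (auto simp: E_def)
  have PE: "P \<otimes> E = E \<otimes> P"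
    using displaces_commute_spread[OF s dS S.subset PS, of cs 0] Cons.prems s by (auto simp: E_def)
  have "h \<otimes> s \<otimes> inv h \<otimes> inv s = P \<otimes> inv E"
    using h s by (simp add: P_def[symmetric] E_def[symmetric] word_simps)
  then have c: "h \<otimes> (s \<otimes> (inv h \<otimes> (inv s \<otimes> y))) = P \<otimes> (inv E \<otimes> y)" if "y \<in> carrier G" for y
    using that h(1) s by (simp add: m_assoc[symmetric])
  \<comment> \<open>The place \<open>0\<close> holds the new total product \<open>c P\<close>, and the old \<open>h\<close> moves one place on.\<close>
  let ?k = "c \<otimes> P \<otimes> (s \<otimes> h \<otimes> inv s)"
  have "(?k \<otimes> s \<otimes> inv ?k \<otimes> inv s) \<otimes> spread s (c # cs)
      = c \<otimes> P \<otimes> s \<otimes> (h \<otimes> (s \<otimes> (inv h \<otimes> (inv s \<otimes> (inv P \<otimes> E \<otimes> inv s)))))"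
    using h(1) s by (simp add: E_def[symmetric] word_simps)
  also have "\<dots> = c \<otimes> P"
    using s commute_simps[OF _ _ PE] by (subst c) (simp_all add: word_simps)
  finally have "list_prod G (c # cs) = (?k \<otimes> s \<otimes> inv ?k \<otimes> inv s) \<otimes> spread s (c # cs)"
    by (simp add: P_def)
  then show ?case
    using h s by (intro bexI[of _ ?k]) auto
qed

text \<open>Displaced factors commute with one another, so commutators of products split by \<open>commutator_mult\<close>.
  Whatever the number of commutators, their spread is one single commutator.\<close>

lemma spread_commutators:
  assumes s: "s \<in> carrier G" and S: "displaces s S" "S \<subseteq> carrier G" and ps: "set ps \<subseteq> S \<times> S"
  shows "spread s (map (\<lambda>(u, v). u \<otimes> v \<otimes> inv u \<otimes> inv v) ps)
    = spread s (map fst ps) \<otimes> spread s (map snd ps)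
      \<otimes> inv (spread s (map fst ps)) \<otimes> inv (spread s (map snd ps))"
  using ps
proof (induction ps)
  case (Cons p ps)
  obtain u v where p: "p = (u, v)" by (cases p)
  define U where "U = spread s (map fst ps)"
  define V where "V = spread s (map snd ps)"
  have uv: "u \<in> S" "v \<in> S" using Cons.prems p by auto
  have fs: "set (map fst ps) \<subseteq> S" "set (map snd ps) \<subseteq> S" using Cons.prems by auto
  have [simp]: "u \<in> carrier G" "v \<in> carrier G" "U \<in> carrier G" "V \<in> carrier G"
    using uv S fs s unfolding U_def V_def by (auto intro!: spread_closed)
  note com = displaces_commute_spread[OF s S, of _ _ 0]
  have c: "u \<otimes> U = U \<otimes> u" "u \<otimes> V = V \<otimes> u" "v \<otimes> U = U \<otimes> v" "v \<otimes> V = V \<otimes> v"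
    using com[OF uv(1) fs(1)] com[OF uv(1) fs(2)] com[OF uv(2) fs(1)] com[OF uv(2) fs(2)]
    by (simp_all flip: U_def V_def)
  have "spread s (map (\<lambda>(u, v). u \<otimes> v \<otimes> inv u \<otimes> inv v) (p # ps))
      = s \<otimes> ((u \<otimes> v \<otimes> inv u \<otimes> inv v) \<otimes> (U \<otimes> V \<otimes> inv U \<otimes> inv V)) \<otimes> inv s"
    using Cons p by (simp add: U_def V_def)
  also have "\<dots> = s \<otimes> ((u \<otimes> U) \<otimes> (v \<otimes> V) \<otimes> inv (u \<otimes> U) \<otimes> inv (v \<otimes> V)) \<otimes> inv s"
    by (subst commutator_mult) (simp_all add: c)
  also have "\<dots> = (s \<otimes> (u \<otimes> U) \<otimes> inv s) \<otimes> (s \<otimes> (v \<otimes> V) \<otimes> inv s)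
      \<otimes> inv (s \<otimes> (u \<otimes> U) \<otimes> inv s) \<otimes> inv (s \<otimes> (v \<otimes> V) \<otimes> inv s)"
    using s by (simp add: word_simps)
  finally show ?case
    by (simp add: p U_def V_def)
qed simp

lemma derived_eq_list_prod_commutators:
  assumes "F \<subseteq> carrier G" "d \<in> derived G F"
  shows "\<exists>ps. set ps \<subseteq> F \<times> F \<and> d = list_prod G (map (\<lambda>(u, v). u \<otimes> v \<otimes> inv u \<otimes> inv v) ps)"
  using assms(2) unfolding derived_def
proof induction
  case one
  show ?case by (intro exI[of _ "[]"]) auto
next
  case (incl h)
  then obtain u v where "u \<in> F" "v \<in> F" "h = u \<otimes> v \<otimes> inv u \<otimes> inv v" by auto
  then show ?case using assms(1) by (intro exI[of _ "[(u, v)]"]) (auto simp: subset_iff)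
next
  case (inv h)
  then obtain u v where "u \<in> F" "v \<in> F" "h = u \<otimes> v \<otimes> inv u \<otimes> inv v" by auto
  then show ?case using assms(1) by (intro exI[of _ "[(v, u)]"]) (auto simp: word_simps subset_iff)
next
  case (eng a b)
  then obtain ps qs where pq: "set ps \<subseteq> F \<times> F" "a = list_prod G (map (\<lambda>(u, v). u \<otimes> v \<otimes> inv u \<otimes> inv v) ps)"
    "set qs \<subseteq> F \<times> F" "b = list_prod G (map (\<lambda>(u, v). u \<otimes> v \<otimes> inv u \<otimes> inv v) qs)"
    by auto
  have "set (map (\<lambda>(u, v). u \<otimes> v \<otimes> inv u \<otimes> inv v) xs) \<subseteq> carrier G" if "set xs \<subseteq> F \<times> F" for xs
    using that assms(1) by (auto simp: subset_iff)
  then show ?case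
    using pq by (intro exI[of _ "ps @ qs"]) (simp add: list_prod_append)
qed

end


context marked_group
begin

lemma list_prod_pal_products:
  "set ps \<subseteq> palindromes G X \<Longrightarrow> list_prod G ps \<in> pal_products (length ps)"
  unfolding products_le_def by blast

text \<open>With \<open>A = s U' s\<^sup>-\<^sup>1\<close> and \<open>B = s\<^sup>2 V' s\<^sup>-\<^sup>2\<close>, the displaced reversals commute with \<open>U\<close>, \<open>V\<close> and with
  each other, so \<open>[U, V] = [U A, V B]\<close>. Written out, the right side is a product of seven
  palindromes, because \<open>U A = (U s U') s\<^sup>-\<^sup>1\<close> and \<open>V B = (V s\<^sup>2 V') s\<^sup>-\<^sup>2\<close>.\<close>

lemma commutator_pal_products:
  assumes t: "t \<in> X" and U: "is_reversal G X U U'" and V: "is_reversal G X V V'"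
    and disp: "displaces (t [^] (m::int)) {U, V, U', V'}"
  shows "U \<otimes> V \<otimes> inv U \<otimes> inv V \<in> pal_products 7"
proof -
  define s where "s = t [^] m"
  have tG: "t \<in> carrier G" using t by simp
  have sG[simp]: "s \<in> carrier G" using tG by (simp add: s_def)
  have [simp]: "U \<in> carrier G" "V \<in> carrier G" "U' \<in> carrier G" "V' \<in> carrier G"
    using U V by (simp_all add: reversal_closed)
  define A where "A = s \<otimes> U' \<otimes> inv s"
  define B where "B = s \<otimes> s \<otimes> V' \<otimes> inv (s \<otimes> s)"
  have [simp]: "A \<in> carrier G" "B \<in> carrier G" by (simp_all add: A_def B_def)
  have d: "x \<otimes> (s [^] j \<otimes> y \<otimes> inv (s [^] j)) = (s [^] j \<otimes> y \<otimes> inv (s [^] j)) \<otimes> x"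
    if "x \<in> {U, V, U', V'}" "y \<in> {U, V, U', V'}" "j > 0" for x y and j :: nat
    using disp that unfolding displaces_def s_def by blast
  have s2: "s [^] (2::nat) = s \<otimes> s" "s [^] (1::nat) = s"
    by (simp_all add: numeral_2_eq_2)
  have UA: "U \<otimes> A = A \<otimes> U" "V \<otimes> A = A \<otimes> V"
    using d[of U U' 1] d[of V U' 1] by (simp_all add: A_def s2)
  have UB: "U \<otimes> B = B \<otimes> U" "V \<otimes> B = B \<otimes> V"
    using d[of U V' 2] d[of V V' 2] by (simp_all only: B_def s2) simp_all
  have "U' \<otimes> (s \<otimes> V' \<otimes> inv s) = (s \<otimes> V' \<otimes> inv s) \<otimes> U'"
    using d[of U' V' 1] by (simp add: s2)
  then have "s \<otimes> (U' \<otimes> (s \<otimes> V' \<otimes> inv s)) \<otimes> inv s = s \<otimes> ((s \<otimes> V' \<otimes> inv s) \<otimes> U') \<otimes> inv s"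
    by simp
  then have AB: "A \<otimes> B = B \<otimes> A"
    by (simp add: A_def B_def word_simps)
  have "(U \<otimes> A) \<otimes> (V \<otimes> B) \<otimes> inv (U \<otimes> A) \<otimes> inv (V \<otimes> B)
      = (U \<otimes> V \<otimes> inv U \<otimes> inv V) \<otimes> (A \<otimes> B \<otimes> inv A \<otimes> inv B)"
    by (intro commutator_mult UA UB) simp_all
  also have "\<dots> = U \<otimes> V \<otimes> inv U \<otimes> inv V"
    using commute_simps[OF _ _ AB] by (simp add: word_simps)
  finally have "U \<otimes> V \<otimes> inv U \<otimes> inv V
      = (U \<otimes> A) \<otimes> (V \<otimes> B) \<otimes> inv (U \<otimes> A) \<otimes> inv (V \<otimes> B)" ..
  also have "\<dots> = (U \<otimes> s \<otimes> U') \<otimes> (inv s \<otimes> ((V \<otimes> (s \<otimes> s) \<otimes> V') \<otimes> (inv s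
      \<otimes> ((inv U' \<otimes> inv s \<otimes> inv U) \<otimes> ((s \<otimes> s) \<otimes> (inv V' \<otimes> inv (s \<otimes> s) \<otimes> inv V))))))"
    by (simp add: A_def B_def word_simps)
  also have "\<dots> \<in> pal_products 7"
  proof -
    have "s \<otimes> s = t [^] (m + m)"
      unfolding s_def using tG by (rule int_pow_mult[symmetric])
    then have P: "s \<in> palindromes G X" "s \<otimes> s \<in> palindromes G X"
      using palindrome_int_pow[OF t] by (simp_all add: s_def)
    note rU = reversal_inv[OF reversal_sym[OF U]] and rV = reversal_inv[OF reversal_sym[OF V]]
    let ?ps = "[U \<otimes> s \<otimes> U', inv s, V \<otimes> (s \<otimes> s) \<otimes> V', inv s,
      inv U' \<otimes> inv s \<otimes> inv U, s \<otimes> s, inv V' \<otimes> inv (s \<otimes> s) \<otimes> inv V]"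
    note Pi = palindrome_inv[OF P(1)] palindrome_inv[OF P(2)]
    have "set ?ps \<subseteq> palindromes G X"
      using P Pi palindrome_extend[OF U P(1)] palindrome_extend[OF V P(2)]
        palindrome_extend[OF rU Pi(1)] palindrome_extend[OF rV Pi(2)]
      by (simp del: inv_mult_group)
    then have "list_prod G ?ps \<in> pal_products (length ?ps)"
      by (rule list_prod_pal_products)
    then show ?thesis by (simp add: eval_nat_numeral)
  qed
  finally show ?thesis .
qed

text \<open>Displacement asks for all positive powers, hence the assumption on all exponents that are large in
  absolute value.\<close>

lemma int_pow_displaces:
  assumes t: "t \<in> carrier G" and M: "M > 0"
    and com: "\<And>a b i. a \<in> S \<Longrightarrow> b \<in> S \<Longrightarrow> \<bar>i\<bar> \<ge> M
      \<Longrightarrow> a \<otimes> (t [^] (i::int) \<otimes> b \<otimes> inv (t [^] i)) = (t [^] i \<otimes> b \<otimes> inv (t [^] i)) \<otimes> a"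
  shows "displaces (t [^] M) S"
  unfolding displaces_def
proof (intro ballI allI impI)
  fix x y and j :: nat assume "x \<in> S" "y \<in> S" "j > 0"
  have "(t [^] M) [^] j = t [^] (M * int j)"
    using t by (simp add: int_pow_pow flip: int_pow_int)
  moreover have "\<bar>M * int j\<bar> \<ge> M"
    using M \<open>j > 0\<close> by (simp add: abs_mult)
  ultimately show "x \<otimes> ((t [^] M) [^] j \<otimes> y \<otimes> inv ((t [^] M) [^] j))
      = (t [^] M) [^] j \<otimes> y \<otimes> inv ((t [^] M) [^] j) \<otimes> x"
    using com[OF \<open>x \<in> S\<close> \<open>y \<in> S\<close>] by simp
qed

lemma finite_displaced:
  assumes t: "t \<in> carrier G" and S: "finite S" "S \<subseteq> F"
    and disp: "\<And>a b. a \<in> F \<Longrightarrow> b \<in> F \<Longrightarrow> \<exists>M. \<forall>i::int. \<bar>i\<bar> \<ge> M \<longrightarrow>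
      a \<otimes> (t [^] i \<otimes> b \<otimes> inv (t [^] i)) = (t [^] i \<otimes> b \<otimes> inv (t [^] i)) \<otimes> a"
  shows "\<exists>M::int. displaces (t [^] M) S"
proof -
  have "\<forall>p\<in>S \<times> S. \<exists>M. \<forall>i::int. \<bar>i\<bar> \<ge> M \<longrightarrow>
      fst p \<otimes> (t [^] i \<otimes> snd p \<otimes> inv (t [^] i)) = (t [^] i \<otimes> snd p \<otimes> inv (t [^] i)) \<otimes> fst p"
    using S(2) by (intro ballI disp) auto
  then obtain f :: "'a \<times> 'a \<Rightarrow> int" where f: "\<forall>p\<in>S \<times> S. \<forall>i::int. \<bar>i\<bar> \<ge> f p \<longrightarrow>
      fst p \<otimes> (t [^] i \<otimes> snd p \<otimes> inv (t [^] i)) = (t [^] i \<otimes> snd p \<otimes> inv (t [^] i)) \<otimes> fst p"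
    by metis
  define M where "M = Max (insert 1 (f ` (S \<times> S)))"
  have M: "1 \<le> M" "\<And>p. p \<in> S \<times> S \<Longrightarrow> f p \<le> M"
    using S(1) by (auto simp: M_def)
  have "displaces (t [^] M) S"
  proof (rule int_pow_displaces[OF t])
    fix a b and i :: int assume "a \<in> S" "b \<in> S" "\<bar>i\<bar> \<ge> M"
    then show "a \<otimes> (t [^] i \<otimes> b \<otimes> inv (t [^] i)) = (t [^] i \<otimes> b \<otimes> inv (t [^] i)) \<otimes> a"
      using f[rule_format, of "(a, b)" i] M(2)[of "(a, b)"] by simp
  qed (use M in simp)
  then show ?thesis ..
qed

text \<open>Three palindromes pay for \<open>[h, s]\<close>, which spreads the product of commutators, and seven for the single
  commutator \<open>[U, V]\<close> that is left. The exponent for \<open>[U, V]\<close> is chosen after the one in \<open>s\<close>, because it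
  has to displace \<open>U\<close> and \<open>V\<close>, which depend on \<open>s\<close>.\<close>

lemma derived_pal_products:
  assumes t: "t \<in> X" and F: "F \<lhd> G"
    and rev: "\<And>a a'. a \<in> F \<Longrightarrow> is_reversal G X a a' \<Longrightarrow> a' \<in> F"
    and disp: "\<And>a b. a \<in> F \<Longrightarrow> b \<in> F \<Longrightarrow> \<exists>M. \<forall>i::int. \<bar>i\<bar> \<ge> M \<longrightarrow>
      a \<otimes> (t [^] i \<otimes> b \<otimes> inv (t [^] i)) = (t [^] i \<otimes> b \<otimes> inv (t [^] i)) \<otimes> a"
  shows "derived G F \<subseteq> pal_products 10"
proof
  fix d assume "d \<in> derived G F"
  interpret F: normal F G by fact
  let ?com = "\<lambda>(u, v). u \<otimes> v \<otimes> inv u \<otimes> inv v"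
  have tG: "t \<in> carrier G" using t by simp
  obtain ps where ps: "set ps \<subseteq> F \<times> F" and d: "d = list_prod G (map ?com ps)"
    using derived_eq_list_prod_commutators[OF F.subset \<open>d \<in> derived G F\<close>] by blast
  define S where "S = fst ` set ps \<union> snd ` set ps"
  have S: "finite S" "S \<subseteq> F" using ps by (auto simp: S_def)
  then obtain M :: int where M: "displaces (t [^] M) S"
    using finite_displaced[OF tG _ _ disp] by blast
  define s where "s = t [^] M"
  have s: "s \<in> carrier G" "s \<in> palindromes G X"
    using t tG by (simp_all add: s_def palindrome_int_pow)
  have SG: "S \<subseteq> carrier G" using S F.subset by blast
  have subS: "subgroup (generate G S) G" by (rule generate_is_subgroup[OF SG])
  interpret S: subgroup "generate G S" G by (rule subS)
  have psS: "(u, v) \<in> set ps \<Longrightarrow> u \<in> S \<and> v \<in> S" for u v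
    by (force simp: S_def)
  then have "set (map ?com ps) \<subseteq> generate G S"
    using generate.incl[of _ S G] by auto
  then obtain h where h: "h \<in> carrier G"
      "d = (h \<otimes> s \<otimes> inv h \<otimes> inv s) \<otimes> spread s (map ?com ps)"
    using list_prod_eq_commutator_spread[OF s(1) displaces_generate[OF s(1) M[folded s_def] SG] subS]
    unfolding d by blast
  define U where "U = spread s (map fst ps)"
  define V where "V = spread s (map snd ps)"
  have UV: "spread s (map ?com ps) = U \<otimes> V \<otimes> inv U \<otimes> inv V"
    unfolding U_def V_def using M SG psS
    by (intro spread_commutators[of _ S]) (auto simp: s(1), simp add: s_def)
  have spreadF: "spread s as \<in> F" if "set as \<subseteq> F" for as
    using that by (induction as) (auto intro!: F.inv_op_closed2 s(1))
  have "set (map fst ps) \<subseteq> F" "set (map snd ps) \<subseteq> F"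
    using ps by auto
  then have UF: "U \<in> F" "V \<in> F"
    unfolding U_def V_def by (blast intro: spreadF)+
  obtain U' where U': "is_reversal G X U U'"
    using reversal_exists[of U] UF by auto
  obtain V' where V': "is_reversal G X V V'"
    using reversal_exists[of V] UF by auto
  have "{U, V, U', V'} \<subseteq> F"
    using rev U' V' UF by auto
  from finite_displaced[OF tG _ this disp] obtain m :: int
    where "displaces (t [^] m) {U, V, U', V'}" by auto
  then have "U \<otimes> V \<otimes> inv U \<otimes> inv V \<in> pal_products 7"
    by (rule commutator_pal_products[OF t U' V'])
  then show "d \<in> pal_products 10"
    unfolding h(2) UV
    by (rule palindromes_mult[OF commutator_palindrome[OF h(1) s(2)]]) simp
qed

end

section \<open>The structure of wreath products\<close>

locale wreath_product = B: group B + A: group A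
  for B :: "('b, 'm) monoid_scheme" and A :: "('a, 'n) monoid_scheme"
begin

abbreviation W where "W \<equiv> B \<wr> A"

abbreviation top where "top \<equiv> in_top B A"

abbreviation base where "base \<equiv> in_base B A"

abbreviation F where "F \<equiv> kernel W A snd"

sublocale W: group W
  by (rule group_wreath) unfold_locales

lemma wreath_carrier_iff:
  "(f, a) \<in> carrier W \<longleftrightarrow>
    f \<in> carrier A \<rightarrow>\<^sub>E carrier B \<and> finite {x \<in> carrier A. f x \<noteq> \<one>\<^bsub>B\<^esub>} \<and> a \<in> carrier A"
  by (auto simp: wreath_def carrier_base_group[OF B.is_group])

lemma wreath_mult:
  "a \<in> carrier A \<Longrightarrow> (f, a) \<otimes>\<^bsub>W\<^esub> (g, b)
    = (\<lambda>x\<in>carrier A. f x \<otimes>\<^bsub>B\<^esub> g (inv\<^bsub>A\<^esub> a \<otimes>\<^bsub>A\<^esub> x), a \<otimes>\<^bsub>A\<^esub> b)"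
  by (auto simp: wreath_def mult_base_group shift_def intro!: restrict_ext)

lemma wreath_one: "\<one>\<^bsub>W\<^esub> = (\<lambda>x\<in>carrier A. \<one>\<^bsub>B\<^esub>, \<one>\<^bsub>A\<^esub>)"
  by (simp add: wreath_def one_base_group)

lemma top_eq: "top a = (\<lambda>x\<in>carrier A. \<one>\<^bsub>B\<^esub>, a)"
  by (simp add: in_top_def one_base_group)

lemma snd_hom: "snd \<in> hom W A"
  by (rule homI) (auto simp: wreath_carrier_iff wreath_mult)

sublocale snd: group_hom W A snd
  using snd_hom by unfold_locales

lemma F_normal: "F \<lhd> W"
  by (rule snd.normal_kernel)

lemma F_iff: "u \<in> F \<longleftrightarrow> u \<in> carrier W \<and> snd u = \<one>\<^bsub>A\<^esub>"
  by (auto simp: kernel_def)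

lemma F_carrier [simp]: "u \<in> F \<Longrightarrow> u \<in> carrier W"
  by (simp add: F_iff)

lemma coord_closed [simp]: "u \<in> carrier W \<Longrightarrow> x \<in> carrier A \<Longrightarrow> fst u x \<in> carrier B"
  by (cases u) (auto simp: wreath_carrier_iff)

lemma finite_support: "u \<in> carrier W \<Longrightarrow> finite {x \<in> carrier A. fst u x \<noteq> \<one>\<^bsub>B\<^esub>}"
  by (cases u) (auto simp: wreath_carrier_iff)

lemma coord_mult:
  assumes "u \<in> F" "x \<in> carrier A"
  shows "fst (u \<otimes>\<^bsub>W\<^esub> v) x = fst u x \<otimes>\<^bsub>B\<^esub> fst v x"
  using assms by (cases u; cases v) (auto simp: F_iff wreath_mult)

lemma coord_one: "x \<in> carrier A \<Longrightarrow> fst \<one>\<^bsub>W\<^esub> x = \<one>\<^bsub>B\<^esub>"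
  by (simp add: wreath_one)

lemma F_eqI:
  assumes "u \<in> F" "v \<in> F" "\<And>x. x \<in> carrier A \<Longrightarrow> fst u x = fst v x"
  shows "u = v"
proof (rule prod_eqI)
  show "fst u = fst v"
    using assms by (cases u; cases v) (auto simp: F_iff wreath_carrier_iff intro: PiE_ext)
qed (use assms in \<open>simp add: F_iff\<close>)

lemma top_hom: "top \<in> hom A W"
  by (rule homI) (auto simp: top_eq wreath_carrier_iff wreath_mult intro!: restrict_ext)

sublocale top: group_hom A W top
  using top_hom by unfold_locales

lemma base_closed: "b \<in> carrier B \<Longrightarrow> base b \<in> F"
  by (auto simp: F_iff in_base_def wreath_carrier_iff intro: finite_subset[of _ "{\<one>\<^bsub>A\<^esub>}"])

lemma base_coord: "x \<in> carrier A \<Longrightarrow> fst (base b) x = (if x = \<one>\<^bsub>A\<^esub> then b else \<one>\<^bsub>B\<^esub>)"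
  by (simp add: in_base_def)

lemma base_hom: "base \<in> hom B W"
proof (rule homI)
  interpret F: normal F W by (rule F_normal)
  fix b c assume bc: "b \<in> carrier B" "c \<in> carrier B"
  show "base (b \<otimes>\<^bsub>B\<^esub> c) = base b \<otimes>\<^bsub>W\<^esub> base c"
    using bc by (intro F_eqI F.m_closed) (auto simp: base_closed coord_mult base_coord)
qed (use base_closed in auto)

sublocale base: group_hom B W base
  using base_hom by unfold_locales

lemma conj_top_coord:
  assumes a: "a \<in> carrier A" and u: "u \<in> F" and x: "x \<in> carrier A"
  shows "fst (top a \<otimes>\<^bsub>W\<^esub> u \<otimes>\<^bsub>W\<^esub> inv\<^bsub>W\<^esub> top a) x = fst u (inv\<^bsub>A\<^esub> a \<otimes>\<^bsub>A\<^esub> x)"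
proof -
  obtain f where f: "u = (f, \<one>\<^bsub>A\<^esub>)" using u by (cases u) (auto simp: F_iff)
  have "inv\<^bsub>W\<^esub> top a = top (inv\<^bsub>A\<^esub> a)" using a by simp
  moreover have "f (inv\<^bsub>A\<^esub> a \<otimes>\<^bsub>A\<^esub> x) \<in> carrier B"
    using coord_closed[of u] a u x by (simp add: f)
  ultimately show ?thesis
    using a x by (simp add: f top_eq wreath_mult)
qed

lemma conj_top_closed:
  assumes "a \<in> carrier A" "u \<in> F"
  shows "top a \<otimes>\<^bsub>W\<^esub> u \<otimes>\<^bsub>W\<^esub> inv\<^bsub>W\<^esub> top a \<in> F"
  using assms by (intro normal.inv_op_closed2[OF F_normal]) auto

lemma disjoint_support_commute:
  assumes u: "u \<in> F" and v: "v \<in> F"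
    and disj: "\<And>x. x \<in> carrier A \<Longrightarrow> fst u x = \<one>\<^bsub>B\<^esub> \<or> fst v x = \<one>\<^bsub>B\<^esub>"
  shows "u \<otimes>\<^bsub>W\<^esub> v = v \<otimes>\<^bsub>W\<^esub> u"
proof -
  interpret F: normal F W by (rule F_normal)
  show ?thesis
  proof (intro F_eqI F.m_closed u v)
    fix x assume x: "x \<in> carrier A"
    then show "fst (u \<otimes>\<^bsub>W\<^esub> v) x = fst (v \<otimes>\<^bsub>W\<^esub> u) x"
      using disj[OF x] u v by (auto simp: coord_mult)
  qed
qed

lemma wreath_decompose:
  assumes "w \<in> carrier W"
  obtains u where "u \<in> F" "\<And>x. x \<in> carrier A \<Longrightarrow> fst u x = fst w x"
    "w = u \<otimes>\<^bsub>W\<^esub> top (snd w)" "snd w \<in> carrier A"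
proof -
  obtain f a where w: "w = (f, a)" by (cases w)
  have fa: "f \<in> carrier A \<rightarrow>\<^sub>E carrier B" "a \<in> carrier A"
    using assms by (auto simp: w wreath_carrier_iff)
  have u: "(f, \<one>\<^bsub>A\<^esub>) \<in> F"
    using assms by (auto simp: w F_iff wreath_carrier_iff)
  have eq: "(\<lambda>x\<in>carrier A. f x) = f"
    using fa by (auto simp: PiE_iff extensional_restrict)
  have "(\<lambda>x\<in>carrier A. f x \<otimes>\<^bsub>B\<^esub> (\<lambda>x\<in>carrier A. \<one>\<^bsub>B\<^esub>) (inv\<^bsub>A\<^esub> \<one>\<^bsub>A\<^esub> \<otimes>\<^bsub>A\<^esub> x)) = (\<lambda>x\<in>carrier A. f x)"
    using fa by (intro restrict_ext) (auto simp: PiE_iff)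
  then have "w = (f, \<one>\<^bsub>A\<^esub>) \<otimes>\<^bsub>W\<^esub> top (snd w)"
    using fa eq by (simp add: w top_eq wreath_mult)
  from that[OF u _ this] show thesis
    using fa by (simp add: w)
qed

text \<open>An element of the base group is the product of its coordinates, each being the conjugate of an element
  at the coordinate \<open>1\<close>. The proof removes one coordinate of the support at a time.\<close>

lemma base_group_induct:
  assumes one: "\<one>\<^bsub>W\<^esub> \<in> S" and mult: "\<And>u v. u \<in> S \<Longrightarrow> v \<in> S \<Longrightarrow> u \<otimes>\<^bsub>W\<^esub> v \<in> S"
    and piece: "\<And>a b. a \<in> carrier A \<Longrightarrow> b \<in> B0 \<Longrightarrow> top a \<otimes>\<^bsub>W\<^esub> base b \<otimes>\<^bsub>W\<^esub> inv\<^bsub>W\<^esub> top a \<in> S"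
    and B0: "B0 \<subseteq> carrier B" and u: "u \<in> F" "\<And>x. x \<in> carrier A \<Longrightarrow> fst u x \<in> B0"
  shows "u \<in> S"
proof -
  interpret F: normal F W by (rule F_normal)
  have *: "u \<in> S" if "finite T" "T \<subseteq> carrier A" "u \<in> F" "{x \<in> carrier A. fst u x \<noteq> \<one>\<^bsub>B\<^esub>} \<subseteq> T"
    "\<And>x. x \<in> T \<Longrightarrow> fst u x \<in> B0" for T u
    using that
  proof (induction T arbitrary: u)
    case empty
    then have "u = \<one>\<^bsub>W\<^esub>"
      by (intro F_eqI F.one_closed) (auto simp: coord_one)
    then show ?case using one by simp
  next
    case (insert a T)
    have aA: "a \<in> carrier A" and ua: "fst u a \<in> B0" using insert.prems by auto
    let ?p = "top a \<otimes>\<^bsub>W\<^esub> base (fst u a) \<otimes>\<^bsub>W\<^esub> inv\<^bsub>W\<^esub> top a"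
    define v where "v = (\<lambda>x\<in>carrier A. if x = a then \<one>\<^bsub>B\<^esub> else fst u x, \<one>\<^bsub>A\<^esub>)"
    have uF: "u \<in> F" by fact
    then have uW: "u \<in> carrier W" by simp
    have v: "v \<in> F"
    proof -
      have "fst u x \<noteq> \<one>\<^bsub>B\<^esub>" if "x \<in> carrier A" "fst v x \<noteq> \<one>\<^bsub>B\<^esub>" for x
        using that by (simp add: v_def split: if_splits)
      then have "{x \<in> carrier A. fst v x \<noteq> \<one>\<^bsub>B\<^esub>} \<subseteq> {x \<in> carrier A. fst u x \<noteq> \<one>\<^bsub>B\<^esub>}"
        by blast
      then have "finite {x \<in> carrier A. fst v x \<noteq> \<one>\<^bsub>B\<^esub>}"
        using finite_support[OF uW] by (rule finite_subset)
      moreover have "fst v \<in> carrier A \<rightarrow>\<^sub>E carrier B"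
        using coord_closed[OF uW] by (simp add: v_def)
      ultimately show ?thesis
        unfolding F_iff by (simp add: v_def wreath_carrier_iff)
    qed
    have vx: "fst v x = (if x = a then \<one>\<^bsub>B\<^esub> else fst u x)" if "x \<in> carrier A" for x
      using that by (simp add: v_def)
    have p: "?p \<in> F"
      using aA ua B0 by (intro conj_top_closed base_closed) auto
    have "u = ?p \<otimes>\<^bsub>W\<^esub> v"
    proof (rule F_eqI[OF uF F.m_closed[OF p v]])
      fix x assume x: "x \<in> carrier A"
      have "inv\<^bsub>A\<^esub> a \<otimes>\<^bsub>A\<^esub> x = \<one>\<^bsub>A\<^esub> \<longleftrightarrow> x = a"
        using aA x by (simp add: A.inv_solve_left')
      then show "fst u x = fst (?p \<otimes>\<^bsub>W\<^esub> v) x"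
        using aA ua B0 x uW p by (auto simp: coord_mult conj_top_coord base_closed base_coord vx)
    qed
    moreover have "v \<in> S"
    proof (rule insert.IH[OF _ v])
      show "T \<subseteq> carrier A" "{x \<in> carrier A. fst v x \<noteq> \<one>\<^bsub>B\<^esub>} \<subseteq> T"
        using insert.prems by (auto simp: vx split: if_splits)
      show "fst v x \<in> B0" if "x \<in> T" for x
        using insert that by (auto simp: vx)
    qed
    ultimately show ?case
      using mult piece[OF aA ua] by metis
  qed
  show ?thesis
    using u finite_support[of u] by (intro *[of "{x \<in> carrier A. fst u x \<noteq> \<one>\<^bsub>B\<^esub>}"]) auto
qed

lemma wreath_gens_generate:
  assumes T: "generates A T" and Y: "generates B Y"
  shows "generates W (wreath_gens B A T Y)"
proof -
  let ?X = "wreath_gens B A T Y"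
  have TY: "T \<subseteq> carrier A" "Y \<subseteq> carrier B" "generate A T = carrier A" "generate B Y = carrier B"
    using T Y by (auto simp: generates_def)
  have X: "?X \<subseteq> carrier W"
    using TY F_carrier[OF base_closed] by (auto simp: wreath_gens_def subset_iff)
  interpret M: subgroup "generate W ?X" W
    using X by (rule W.generate_is_subgroup)
  have top: "top a \<in> generate W ?X" if "a \<in> carrier A" for a
    using top.generate_img[OF TY(1)] TY(3) that W.mono_generate[of "top ` T" ?X]
    by (auto simp: wreath_gens_def)
  have base: "base b \<in> generate W ?X" if "b \<in> carrier B" for b
    using base.generate_img[OF TY(2)] TY(4) that W.mono_generate[of "base ` Y" ?X]
    by (auto simp: wreath_gens_def)
  have "w \<in> generate W ?X" if w: "w \<in> carrier W" for w
  proof -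
    obtain u where u: "u \<in> F" "w = u \<otimes>\<^bsub>W\<^esub> top (snd w)" "snd w \<in> carrier A"
      using wreath_decompose[OF w] by metis
    have "u \<in> generate W ?X"
    proof (rule base_group_induct[of _ "carrier B"])
      fix a b assume "a \<in> carrier A" "b \<in> carrier B"
      then show "top a \<otimes>\<^bsub>W\<^esub> base b \<otimes>\<^bsub>W\<^esub> inv\<^bsub>W\<^esub> top a \<in> generate W ?X"
        using top base by (intro M.m_closed M.m_inv_closed)
    qed (use u in auto)
    then have "u \<otimes>\<^bsub>W\<^esub> top (snd w) \<in> generate W ?X"
      by (intro M.m_closed top u)
    then show ?thesis by (subst u(2))
  qed
  then show ?thesis
    using X M.subset by (auto simp: generates_def)
qed

lemma marked_group_wreath:
  "generates A T \<Longrightarrow> generates B Y \<Longrightarrow> marked_group W (wreath_gens B A T Y)"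
  by unfold_locales (rule wreath_gens_generate)

end

section \<open>Wreath products with an infinite abelian group on top\<close>

lemma (in group) finite_generate_int_pow:
  assumes "x \<in> carrier G" "ord x \<noteq> 0"
  shows "finite (generate G {x})"
proof -
  have "x [^] i \<in> (\<lambda>j. x [^] j) ` {0..<int (ord x)}" for i :: int
  proof
    show "x [^] i = x [^] (i mod int (ord x))"
      unfolding int_pow_eq[OF assms(1)] by (metis dvd_diff_commute dvd_minus_mod)
    show "i mod int (ord x) \<in> {0..<int (ord x)}"
      using assms(2) by simp
  qed
  then have "generate G {x} \<subseteq> (\<lambda>j. x [^] j) ` {0..<int (ord x)}"
    using generate_pow[OF assms(1)] by auto
  then show ?thesis
    by (rule finite_subset) simp
qed

lemma (in comm_group) finite_generate:
  assumes "finite T" "T \<subseteq> carrier G" "\<And>t. t \<in> T \<Longrightarrow> ord t \<noteq> 0"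
  shows "finite (generate G T)"
  using assms
proof (induction T)
  case empty
  then show ?case by (simp add: generate_empty)
next
  case (insert t T)
  have t: "t \<in> carrier G" and T: "T \<subseteq> carrier G" using insert.prems by auto
  have gT: "subgroup (generate G T) G" "subgroup (generate G {t}) G"
    using t T by (auto intro: generate_is_subgroup)
  have "subgroup (generate G {t} <#> generate G T) G"
  proof (rule subgroup_set_mult[OF gT(2,1)])
    fix m a assume m: "m \<in> generate G T" and a: "a \<in> generate G {t}"
    then have "m \<in> carrier G" "a \<in> carrier G"
      using subgroup.mem_carrier[OF gT(1)] subgroup.mem_carrier[OF gT(2)] by auto
    then show "m \<otimes> a \<otimes> inv m \<in> generate G {t}"
      using a by (simp add: m_comm[of m a] m_assoc)
  qed
  moreover have "insert t T \<subseteq> generate G {t} <#> generate G T"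
  proof
    fix x assume "x \<in> insert t T"
    then show "x \<in> generate G {t} <#> generate G T"
    proof
      assume "x = t"
      then show ?thesis
        using t by (intro set_multI[of t _ \<one>]) (auto intro: generate.intros)
    next
      assume "x \<in> T"
      then show ?thesis
        using T by (intro set_multI[of \<one> _ x]) (auto intro: generate.intros)
    qed
  qed
  ultimately have "generate G (insert t T) \<subseteq> generate G {t} <#> generate G T"
    by (intro generate_subgroup_incl)
  moreover have "finite (generate G {t} <#> generate G T)"
    using insert t finite_generate_int_pow[OF t] by (auto simp: set_mult_def)
  ultimately show ?case by (rule finite_subset)
qed

text \<open>Otherwise the group would be a product of finitely many finite cyclic groups.\<close>

lemma (in comm_group) infinite_order_generator:
  assumes "infinite (carrier G)" "finite T" "generates G T"
  obtains t where "t \<in> T" "inj (\<lambda>i::int. t [^] i)"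
proof -
  obtain t where t: "t \<in> T" "ord t = 0"
    using finite_generate[of T] assms by (auto simp: generates_def)
  then have "inj (\<lambda>i::int. t [^] i)"
    using assms(3) by (intro injI) (auto simp: generates_def int_pow_eq)
  then show thesis using that t by blast
qed

context marked_group
begin

text \<open>A word and its reverse have the same image in every abelian quotient. For the projection of a wreath
  product to its abelian top group, this says that reversals of base group elements stay in the base group.\<close>

lemma reversal_comm_image:
  assumes A: "comm_group A" and "group_hom G A \<phi>" and rev: "is_reversal G X g g'"
  shows "\<phi> g' = \<phi> g"
proof -
  interpret A: comm_group A by fact
  interpret group_hom G A \<phi> by fact
  have "\<phi> (word_value G (rev w)) = \<phi> (word_value G w)" if "w \<in> words X" for w
    using that
  proof (induction w)
    case (Cons a w)
    obtain x e where a: "a = (x, e)" by (cases a)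
    have "[(x, e)] \<in> words X" using Cons.prems a by auto
    then show ?case
      using Cons a by (simp add: word_value_append A.m_comm)
  qed simp
  then show ?thesis
    using rev by (auto simp: is_reversal_def)
qed

end

text \<open>An element is \<open>m d a\<close>, where \<open>a\<close> lies in the top group, \<open>d\<close> in \<open>[F, F]\<close>, and \<open>m\<close> is a product of one
  element of each of the subgroups \<open>{[h, t]. h \<in> F}\<close> and \<open>\<langle>y\<rangle>\<close> modulo \<open>[F, F]\<close>. The generators \<open>t\<close>
  contribute four palindromes each, namely three for \<open>[h, t]\<close> and one for the power of \<open>t\<close> in \<open>a\<close>.\<close>

lemma (in wreath_product) abelian_top_width:
  assumes A: "comm_group A" and T: "generates A T" "finite T" and Y: "generates B Y" "finite Y"
    and D: "derived W F \<subseteq> products_le W (palindromes W (wreath_gens B A T Y)) (enat k)"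
  shows "carrier W \<subseteq> products_le W (palindromes W (wreath_gens B A T Y)) (enat (card Y + 4 * card T + k))"
proof
  interpret A: comm_group A by fact
  interpret F: normal F W by (rule F_normal)
  let ?X = "wreath_gens B A T Y"
  interpret W: marked_group W ?X
    using T Y by (intro marked_group_wreath)
  let ?D = "derived W F"
  have DW: "?D \<lhd> W" by (rule W.derived_is_normal[OF F_normal])
  have DF: "?D \<subseteq> F" by (rule W.derived_incl[OF subset_refl F.is_subgroup])
  interpret D: normal ?D W by (rule DW)
  have TA: "T \<subseteq> carrier A" "generate A T = carrier A" and YB: "Y \<subseteq> carrier B" "generate B Y = carrier B"
    using T Y by (auto simp: generates_def)
  have com: "a \<otimes>\<^bsub>W\<^esub> b \<otimes>\<^bsub>W\<^esub> inv\<^bsub>W\<^esub> a \<otimes>\<^bsub>W\<^esub> inv\<^bsub>W\<^esub> b \<in> ?D" if "a \<in> F" "b \<in> F" for a b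
    using that unfolding derived_def by (intro generate.incl) blast
  define N\<^sub>T where "N\<^sub>T = (\<lambda>t. (\<lambda>h. h \<otimes>\<^bsub>W\<^esub> top t \<otimes>\<^bsub>W\<^esub> inv\<^bsub>W\<^esub> h \<otimes>\<^bsub>W\<^esub> inv\<^bsub>W\<^esub> top t) ` F <#>\<^bsub>W\<^esub> ?D)"
  define N\<^sub>Y where "N\<^sub>Y = (\<lambda>y. ?D <#>\<^bsub>W\<^esub> generate W {base y})"
  define N where "N = case_sum N\<^sub>T N\<^sub>Y"
  define n :: "'a + 'b \<Rightarrow> nat" where "n = case_sum (\<lambda>t. 3) (\<lambda>y. 1)"
  have tX: "top t \<in> ?X" if "t \<in> T" for t using that by (auto simp: wreath_gens_def)
  have yX: "base y \<in> ?X" if "y \<in> Y" for y using that by (auto simp: wreath_gens_def)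
  have yF: "base y \<in> F" if "y \<in> Y" for y using that YB by (auto intro: base_closed)
  have tp: "subgroup (N\<^sub>T t) W" "?D \<subseteq> N\<^sub>T t" "N\<^sub>T t \<subseteq> F"
    "h \<in> F \<Longrightarrow> h \<otimes>\<^bsub>W\<^esub> top t \<otimes>\<^bsub>W\<^esub> inv\<^bsub>W\<^esub> h \<otimes>\<^bsub>W\<^esub> inv\<^bsub>W\<^esub> top t \<in> N\<^sub>T t"
    "N\<^sub>T t \<subseteq> W.pal_products 3 <#>\<^bsub>W\<^esub> ?D" if "t \<in> T" for t h
    unfolding N\<^sub>T_def
    by ((rule W.commutator_piece[OF DW F_normal DF com tX]; (rule that | assumption)))+
  have ypal: "base y [^]\<^bsub>W\<^esub> (i::int) \<in> W.pal_products 1" if "y \<in> Y" for y i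
    using W.palindromes_one[OF W.palindrome_int_pow[OF yX[OF that]]] .
  have yp: "subgroup (N\<^sub>Y y) W" "?D \<subseteq> N\<^sub>Y y" "N\<^sub>Y y \<subseteq> F" "base y \<in> N\<^sub>Y y"
    "N\<^sub>Y y \<subseteq> W.pal_products 1 <#>\<^bsub>W\<^esub> ?D" if "y \<in> Y" for y
    unfolding N\<^sub>Y_def
    by ((rule W.cyclic_piece[OF DW F.is_subgroup DF yF ypal]; rule that))+
  have "subgroup (N i) W \<and> ?D \<subseteq> N i \<and> N i \<subseteq> F \<and> N i \<subseteq> W.pal_products (n i) <#>\<^bsub>W\<^esub> ?D"
    if i: "i \<in> T <+> Y" for i
  proof (cases i)
    case (Inl t)
    then have "t \<in> T" using i by auto
    then show ?thesis using tp(1-3,5)[of t] by (simp add: N_def n_def Inl)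
  next
    case (Inr y)
    then have "y \<in> Y" using i by auto
    then show ?thesis using yp[of y] by (simp add: N_def n_def Inr)
  qed
  then have N: "subgroup (N i) W" "?D \<subseteq> N i" "N i \<subseteq> F" "N i \<subseteq> W.pal_products (n i) <#>\<^bsub>W\<^esub> ?D"
    if "i \<in> T <+> Y" for i
    using that by blast+
  let ?M = "generate W (\<Union>i\<in>T <+> Y. N i)"
  have "?M \<subseteq> W.pal_products (\<Sum>i\<in>T <+> Y. n i) <#>\<^bsub>W\<^esub> ?D"
    using N T Y by (intro W.generate_pal_products_mod[OF F.is_subgroup DW com]) auto
  also have "(\<Sum>i\<in>T <+> Y. n i) = card Y + 3 * card T"
    using T Y by (simp add: sum.Plus n_def)
  finally have M_pal: "?M \<subseteq> W.pal_products (card Y + 3 * card T) <#>\<^bsub>W\<^esub> ?D" .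
  have MF: "?M \<subseteq> F"
    using N(3) by (intro W.generate_subgroup_incl F.is_subgroup) blast
  interpret M: subgroup ?M W
    using N(3) F.subset by (intro W.generate_is_subgroup) blast
  have NM: "N i \<subseteq> ?M" if "i \<in> T <+> Y" for i
    using that by (auto intro: generate.incl)
  have baseM: "base b \<in> ?M" if "b \<in> carrier B" for b
  proof -
    have "base y \<in> ?M" if "y \<in> Y" for y
      using that NM[of "Inr y"] yp(4)[OF that] by (auto simp: N_def)
    then have "generate W (base ` Y) \<subseteq> ?M"
      by (intro W.generate_subgroup_incl M.is_subgroup) auto
    then show ?thesis
      using base.generate_img[OF YB(1)] YB(2) that by auto
  qed
  \<comment> \<open>As \<open>t m t\<^sup>-\<^sup>1 = [m, t]\<^sup>-\<^sup>1 m\<close>, a subgroup of \<open>F\<close> that contains all \<open>[h, t]\<close> is normalized by \<open>t\<close>.\<close>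
  have conjT: "top t \<otimes>\<^bsub>W\<^esub> m \<otimes>\<^bsub>W\<^esub> inv\<^bsub>W\<^esub> top t \<in> ?M" "inv\<^bsub>W\<^esub> top t \<otimes>\<^bsub>W\<^esub> m \<otimes>\<^bsub>W\<^esub> top t \<in> ?M"
    if t: "t \<in> T" and m: "m \<in> ?M" for t m
  proof -
    have tW: "top t \<in> carrier W" using t TA by auto
    have mF: "m \<in> F" using m MF by blast
    have cM: "h \<otimes>\<^bsub>W\<^esub> top t \<otimes>\<^bsub>W\<^esub> inv\<^bsub>W\<^esub> h \<otimes>\<^bsub>W\<^esub> inv\<^bsub>W\<^esub> top t \<in> ?M" if "h \<in> F" for h
      using NM[of "Inl t"] tp(4)[OF t that] t by (auto simp: N_def)
    have "inv\<^bsub>W\<^esub> (m \<otimes>\<^bsub>W\<^esub> top t \<otimes>\<^bsub>W\<^esub> inv\<^bsub>W\<^esub> m \<otimes>\<^bsub>W\<^esub> inv\<^bsub>W\<^esub> top t) \<otimes>\<^bsub>W\<^esub> m \<in> ?M"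
      by (intro M.m_closed M.m_inv_closed cM mF m)
    then show "top t \<otimes>\<^bsub>W\<^esub> m \<otimes>\<^bsub>W\<^esub> inv\<^bsub>W\<^esub> top t \<in> ?M"
      using tW mF by (simp add: W.word_simps)
    let ?m' = "inv\<^bsub>W\<^esub> top t \<otimes>\<^bsub>W\<^esub> m \<otimes>\<^bsub>W\<^esub> top t"
    have "?m' \<in> F"
      using tW mF by (rule F.inv_op_closed1)
    then have "(?m' \<otimes>\<^bsub>W\<^esub> top t \<otimes>\<^bsub>W\<^esub> inv\<^bsub>W\<^esub> ?m' \<otimes>\<^bsub>W\<^esub> inv\<^bsub>W\<^esub> top t) \<otimes>\<^bsub>W\<^esub> m \<in> ?M"
      by (intro M.m_closed cM m)
    then show "?m' \<in> ?M"
      using tW mF by (simp add: W.word_simps)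
  qed
  have conj: "top a \<otimes>\<^bsub>W\<^esub> m \<otimes>\<^bsub>W\<^esub> inv\<^bsub>W\<^esub> top a \<in> ?M" if a: "a \<in> carrier A" and m: "m \<in> ?M" for a m
  proof -
    have "a \<in> generate A T" using a TA by simp
    then show ?thesis using m
    proof (induction arbitrary: m)
      case (eng a b)
      have ab: "a \<in> carrier A" "b \<in> carrier A"
        using eng TA by auto
      have "top (a \<otimes>\<^bsub>A\<^esub> b) \<otimes>\<^bsub>W\<^esub> m \<otimes>\<^bsub>W\<^esub> inv\<^bsub>W\<^esub> top (a \<otimes>\<^bsub>A\<^esub> b)
          = top a \<otimes>\<^bsub>W\<^esub> (top b \<otimes>\<^bsub>W\<^esub> m \<otimes>\<^bsub>W\<^esub> inv\<^bsub>W\<^esub> top b) \<otimes>\<^bsub>W\<^esub> inv\<^bsub>W\<^esub> top a"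
        using ab eng.prems M.mem_carrier by (simp add: W.word_simps)
      then show ?case using eng by simp
    next
      case (inv t)
      then have "t \<in> carrier A" using TA by blast
      then show ?case using conjT(2)[OF inv] by simp
    qed (use conjT M.mem_carrier in auto)
  qed
  have FM: "F \<subseteq> ?M"
  proof
    fix u assume u: "u \<in> F"
    show "u \<in> ?M"
    proof (rule base_group_induct[of ?M "carrier B"])
      fix a b assume "a \<in> carrier A" "b \<in> carrier B"
      then show "top a \<otimes>\<^bsub>W\<^esub> base b \<otimes>\<^bsub>W\<^esub> inv\<^bsub>W\<^esub> top a \<in> ?M"
        by (intro conj baseM)
    qed (use u in \<open>auto intro: M.one_closed M.m_closed\<close>)
  qed
  \<comment> \<open>The same decomposition lemma, applied to the abelian top group with trivial \<open>D\<close>.\<close>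
  have top_pal: "top a \<in> W.pal_products (card T)" if a: "a \<in> carrier A" for a
  proof -
    have one: "{\<one>\<^bsub>W\<^esub>} \<lhd> W"
      by (rule W.one_is_normal)
    have tops: "subgroup (top ` carrier A) W"
      by (rule top.img_is_subgroup)
    have tpal: "top t [^]\<^bsub>W\<^esub> (i::int) \<in> W.pal_products 1" if "t \<in> T" for t i
      using W.palindromes_one[OF W.palindrome_int_pow[OF tX[OF that]]] .
    have tt: "top t \<in> top ` carrier A" if "t \<in> T" for t
      using that TA by auto
    have ones: "{\<one>\<^bsub>W\<^esub>} \<subseteq> top ` carrier A"
      using subgroup.one_closed[OF tops] by simp
    note p = W.cyclic_piece[OF one tops ones tt tpal]
    have com1: "x \<otimes>\<^bsub>W\<^esub> y \<otimes>\<^bsub>W\<^esub> inv\<^bsub>W\<^esub> x \<otimes>\<^bsub>W\<^esub> inv\<^bsub>W\<^esub> y \<in> {\<one>\<^bsub>W\<^esub>}"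
      if xy: "x \<in> top ` carrier A" "y \<in> top ` carrier A" for x y
    proof -
      obtain b c where bc: "x = top b" "y = top c" "b \<in> carrier A" "c \<in> carrier A"
        using xy by auto
      have "b \<otimes>\<^bsub>A\<^esub> c \<otimes>\<^bsub>A\<^esub> inv\<^bsub>A\<^esub> b \<otimes>\<^bsub>A\<^esub> inv\<^bsub>A\<^esub> c = \<one>\<^bsub>A\<^esub>"
        using bc by (simp add: A.m_comm[of b c] A.word_simps)
      then have "top (b \<otimes>\<^bsub>A\<^esub> c \<otimes>\<^bsub>A\<^esub> inv\<^bsub>A\<^esub> b \<otimes>\<^bsub>A\<^esub> inv\<^bsub>A\<^esub> c) = \<one>\<^bsub>W\<^esub>" by simp
      then show ?thesis using bc by simp
    qed
    let ?N = "\<lambda>t. {\<one>\<^bsub>W\<^esub>} <#>\<^bsub>W\<^esub> generate W {top t}"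
    have "generate W (\<Union>t\<in>T. ?N t) \<subseteq> W.pal_products (\<Sum>t\<in>T. 1) <#>\<^bsub>W\<^esub> {\<one>\<^bsub>W\<^esub>}"
      using p T by (intro W.generate_pal_products_mod[OF tops one com1]) auto
    also have "\<dots> \<subseteq> W.pal_products (card T)"
    proof
      fix x assume "x \<in> W.pal_products (\<Sum>t\<in>T. 1) <#>\<^bsub>W\<^esub> {\<one>\<^bsub>W\<^esub>}"
      then obtain q where "q \<in> W.pal_products (card T)" "x = q \<otimes>\<^bsub>W\<^esub> \<one>\<^bsub>W\<^esub>"
        unfolding set_mult_def by auto
      then show "x \<in> W.pal_products (card T)" by simp
    qed
    finally have "generate W (top ` T) \<subseteq> W.pal_products (card T)"
      using W.mono_generate[of "top ` T" "\<Union>t\<in>T. ?N t"] p(4) by blast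
    then show ?thesis
      using top.generate_img[OF TA(1)] TA(2) a by auto
  qed
  fix w assume "w \<in> carrier W"
  then obtain u where u: "u \<in> F" "w = u \<otimes>\<^bsub>W\<^esub> top (snd w)" "snd w \<in> carrier A"
    using wreath_decompose by metis
  have "u \<in> W.pal_products (card Y + 3 * card T) <#>\<^bsub>W\<^esub> ?D"
    using u FM M_pal by blast
  then obtain p d where pd: "p \<in> W.pal_products (card Y + 3 * card T)" "d \<in> ?D" "u = p \<otimes>\<^bsub>W\<^esub> d"
    by (auto simp: set_mult_def)
  have "d \<in> W.pal_products k" using pd D by blast
  then have "u \<in> W.pal_products (card Y + 3 * card T + k)"
    unfolding pd(3) by (rule W.palindromes_mult[OF pd(1)]) simp
  then have "u \<otimes>\<^bsub>W\<^esub> top (snd w) \<in> W.pal_products (card Y + 4 * card T + k)"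
    using top_pal[OF u(3)] by (rule W.palindromes_mult) simp
  then show "w \<in> W.pal_products (card Y + 4 * card T + k)"
    by (subst u(2))
qed


context wreath_product
begin

text \<open>A conjugate of \<open>v\<close> by \<open>t\<^sup>i\<close> fails to be disjoint from \<open>u\<close> only if \<open>t\<^sup>i = x y\<^sup>-\<^sup>1\<close> with \<open>x\<close> and \<open>y\<close> in the
  two finite supports. As \<open>t\<close> has infinite order, this happens for finitely many \<open>i\<close>.\<close>

lemma displaced_by_infinite_order:
  assumes t: "t \<in> carrier A" "inj (\<lambda>i::int. t [^]\<^bsub>A\<^esub> i)" and uv: "u \<in> F" "v \<in> F"
  shows "\<exists>M. \<forall>i::int. \<bar>i\<bar> \<ge> M \<longrightarrow>
    u \<otimes>\<^bsub>W\<^esub> (top t [^]\<^bsub>W\<^esub> i \<otimes>\<^bsub>W\<^esub> v \<otimes>\<^bsub>W\<^esub> inv\<^bsub>W\<^esub> (top t [^]\<^bsub>W\<^esub> i))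
    = (top t [^]\<^bsub>W\<^esub> i \<otimes>\<^bsub>W\<^esub> v \<otimes>\<^bsub>W\<^esub> inv\<^bsub>W\<^esub> (top t [^]\<^bsub>W\<^esub> i)) \<otimes>\<^bsub>W\<^esub> u"
proof -
  define Su where "Su = {x \<in> carrier A. fst u x \<noteq> \<one>\<^bsub>B\<^esub>}"
  define Sv where "Sv = {x \<in> carrier A. fst v x \<noteq> \<one>\<^bsub>B\<^esub>}"
  define J where "J = (\<lambda>i::int. t [^]\<^bsub>A\<^esub> i) -` (\<lambda>(x, y). x \<otimes>\<^bsub>A\<^esub> inv\<^bsub>A\<^esub> y) ` (Su \<times> Sv)"
  have "finite Su" "finite Sv"
    using finite_support uv by (simp_all add: Su_def Sv_def)
  then have "finite J"
    unfolding J_def by (intro finite_vimageI t(2)) simp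
  define M where "M = Max (insert 0 (abs ` J)) + 1"
  have M: "\<bar>i\<bar> < M" if "i \<in> J" for i
    using that \<open>finite J\<close> Max_ge[of "insert 0 (abs ` J)" "\<bar>i\<bar>"] unfolding M_def by auto
  have "u \<otimes>\<^bsub>W\<^esub> (top t [^]\<^bsub>W\<^esub> i \<otimes>\<^bsub>W\<^esub> v \<otimes>\<^bsub>W\<^esub> inv\<^bsub>W\<^esub> (top t [^]\<^bsub>W\<^esub> i))
    = (top t [^]\<^bsub>W\<^esub> i \<otimes>\<^bsub>W\<^esub> v \<otimes>\<^bsub>W\<^esub> inv\<^bsub>W\<^esub> (top t [^]\<^bsub>W\<^esub> i)) \<otimes>\<^bsub>W\<^esub> u" if i: "\<bar>i\<bar> \<ge> M" for i :: int
  proof -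
    have ti: "t [^]\<^bsub>A\<^esub> i \<in> carrier A" "top t [^]\<^bsub>W\<^esub> i = top (t [^]\<^bsub>A\<^esub> i)"
      using t(1) by (simp_all add: top.hom_int_pow)
    show ?thesis
      unfolding ti(2)
    proof (rule disjoint_support_commute[OF uv(1) conj_top_closed[OF ti(1) uv(2)]])
      fix x assume x: "x \<in> carrier A"
      let ?y = "inv\<^bsub>A\<^esub> (t [^]\<^bsub>A\<^esub> i) \<otimes>\<^bsub>A\<^esub> x"
      have "t [^]\<^bsub>A\<^esub> i = x \<otimes>\<^bsub>A\<^esub> inv\<^bsub>A\<^esub> ?y" "?y \<in> carrier A"
        using x ti(1) by (simp_all add: A.word_simps)
      then have "i \<in> J" if "x \<in> Su" "?y \<in> Sv"
        using that unfolding J_def vimage_eq by (intro image_eqI[of _ _ "(x, ?y)"]) auto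
      then have "x \<notin> Su \<or> ?y \<notin> Sv"
        using M i by force
      then show "fst u x = \<one>\<^bsub>B\<^esub>
          \<or> fst (top (t [^]\<^bsub>A\<^esub> i) \<otimes>\<^bsub>W\<^esub> v \<otimes>\<^bsub>W\<^esub> inv\<^bsub>W\<^esub> top (t [^]\<^bsub>A\<^esub> i)) x = \<one>\<^bsub>B\<^esub>"
        unfolding conj_top_coord[OF ti(1) uv(2) x] using x \<open>?y \<in> carrier A\<close>
        by (auto simp: Su_def Sv_def)
    qed
  qed
  then show ?thesis by blast
qed

lemma derived_base_group_width:
  assumes A: "comm_group A" "infinite (carrier A)" and T: "generates A T" "finite T"
    and Y: "generates B Y"
  shows "derived W F \<subseteq> products_le W (palindromes W (wreath_gens B A T Y)) (enat 10)"
proof -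
  interpret A: comm_group A by fact
  interpret W: marked_group W "wreath_gens B A T Y"
    using T Y by (intro marked_group_wreath)
  obtain t where t: "t \<in> T" "inj (\<lambda>i::int. t [^]\<^bsub>A\<^esub> i)"
    using A.infinite_order_generator A(2) T by blast
  have tA: "t \<in> carrier A" using t T by (auto simp: generates_def)
  show ?thesis
  proof (rule W.derived_pal_products[OF _ F_normal])
    show "top t \<in> wreath_gens B A T Y" using t by (auto simp: wreath_gens_def)
    fix a a' assume "a \<in> F" "is_reversal W (wreath_gens B A T Y) a a'"
    then show "a' \<in> F"
      using W.reversal_comm_image[OF A(1) snd.group_hom_axioms] W.reversal_closed
      by (auto simp: F_iff)
  qed (rule displaced_by_infinite_order[OF tA t(2)])
qed

lemma derived_base_group_trivial:
  assumes B: "comm_group B"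
  shows "derived W F \<subseteq> {\<one>\<^bsub>W\<^esub>}"
proof -
  interpret B: comm_group B by fact
  interpret F: normal F W by (rule F_normal)
  have "u \<otimes>\<^bsub>W\<^esub> v = v \<otimes>\<^bsub>W\<^esub> u" if "u \<in> F" "v \<in> F" for u v
    using that by (intro F_eqI F.m_closed) (auto simp: coord_mult B.m_comm)
  then have "u \<otimes>\<^bsub>W\<^esub> v \<otimes>\<^bsub>W\<^esub> inv\<^bsub>W\<^esub> u \<otimes>\<^bsub>W\<^esub> inv\<^bsub>W\<^esub> v = \<one>\<^bsub>W\<^esub>" if "u \<in> F" "v \<in> F" for u v
    using that by (simp add: W.word_simps)
  then show ?thesis
    unfolding derived_def by (intro W.generate_subgroup_incl W.triv_subgroup) auto
qed

lemma pw_abelian_top: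
  assumes A: "comm_group A" "infinite (carrier A)" and T: "generates A T" "finite T"
    and Y: "generates B Y" "finite Y"
  shows "pw W (wreath_gens B A T Y) \<le> enat (card Y + 4 * card T + (if comm_group B then 0 else 10))"
  unfolding pw_def
proof (intro width_leI abelian_top_width A T Y)
  interpret A: comm_group A by fact
  interpret W: marked_group W "wreath_gens B A T Y"
    using T Y by (intro marked_group_wreath)
  show "derived W F \<subseteq> W.pal_products (if comm_group B then 0 else 10)"
  proof (cases "comm_group B")
    case True
    then show ?thesis
      using derived_base_group_trivial W.products_le_one[of "palindromes W (wreath_gens B A T Y)" 0] by auto
  next
    case False
    then show ?thesis using derived_base_group_width[OF A T Y(1)] by simp
  qed
qed

end

section \<open>Wreath products with a non-abelian group on top\<close>

lemma (in group) noncommuting_generators: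
  assumes "\<not> comm_group G" "generates G Z"
  obtains z\<^sub>1 z\<^sub>2 where "z\<^sub>1 \<in> Z" "z\<^sub>2 \<in> Z" "z\<^sub>1 \<otimes> z\<^sub>2 \<noteq> z\<^sub>2 \<otimes> z\<^sub>1"
proof (rule ccontr)
  assume "\<not> thesis"
  then have comm_gens: "\<And>z\<^sub>1 z\<^sub>2. z\<^sub>1 \<in> Z \<Longrightarrow> z\<^sub>2 \<in> Z \<Longrightarrow> z\<^sub>1 \<otimes> z\<^sub>2 = z\<^sub>2 \<otimes> z\<^sub>1"
    using that by blast
  have Z: "Z \<subseteq> carrier G" "generate G Z = carrier G"
    using assms(2) by (auto simp: generates_def)
  have *: "x \<otimes> y = y \<otimes> x" if "x \<in> carrier G" "\<And>z. z \<in> Z \<Longrightarrow> x \<otimes> z = z \<otimes> x" "y \<in> carrier G" for x y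
  proof -
    have "generate G Z \<subseteq> {g \<in> carrier G. x \<otimes> g = g \<otimes> x}"
      using that Z by (intro generate_subgroup_incl subgroup_centralizer) auto
    then show ?thesis using that(3) Z by blast
  qed
  have comm_Z: "z \<otimes> y = y \<otimes> z" if "z \<in> Z" "y \<in> carrier G" for z y
    using *[of z y] that Z comm_gens by blast
  have "x \<otimes> y = y \<otimes> x" if "x \<in> carrier G" "y \<in> carrier G" for x y
    using *[of x y] that(1,2) comm_Z by metis
  then have "comm_group G"
    by (rule group_comm_groupI)
  then show False using assms(1) by simp
qed

text \<open>The word \<open>c z\<^sub>2\<^sup>-\<^sup>1 z\<^sub>1\<^sup>-\<^sup>1\<close> with \<open>c = z\<^sub>1 z\<^sub>2\<close> has value \<open>1\<close>, and the reversed word has value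
  \<open>z\<^sub>1\<^sup>-\<^sup>1 z\<^sub>2\<^sup>-\<^sup>1 z\<^sub>1 z\<^sub>2\<close>, which is not \<open>1\<close> if \<open>z\<^sub>1\<close> and \<open>z\<^sub>2\<close> do not commute.\<close>

lemma (in group) nontrivial_reversal_of_one:
  assumes "\<not> comm_group G" "generates G Z"
  shows "\<exists>c\<in>carrier G. generates G (Z \<union> {c}) \<and> (\<exists>q. q \<noteq> \<one> \<and> is_reversal G (Z \<union> {c}) \<one> q)"
proof -
  obtain z\<^sub>1 z\<^sub>2 where z: "z\<^sub>1 \<in> Z" "z\<^sub>2 \<in> Z" "z\<^sub>1 \<otimes> z\<^sub>2 \<noteq> z\<^sub>2 \<otimes> z\<^sub>1"
    using noncommuting_generators[OF assms] .
  have zG: "z\<^sub>1 \<in> carrier G" "z\<^sub>2 \<in> carrier G" "Z \<subseteq> carrier G"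
    using z assms(2) by (auto simp: generates_def)
  define c where "c = z\<^sub>1 \<otimes> z\<^sub>2"
  have c: "c \<in> carrier G" using zG by (simp add: c_def)
  have gen: "generates G (Z \<union> {c})"
    using assms(2) c zG mono_generate[of Z "Z \<union> {c}"] generate_incl[of "Z \<union> {c}"]
    by (auto simp: generates_def)
  interpret marked_group G "Z \<union> {c}"
    using gen by unfold_locales
  have "is_reversal G (Z \<union> {c}) (c \<otimes> (inv z\<^sub>2 \<otimes> inv z\<^sub>1)) ((inv z\<^sub>1 \<otimes> inv z\<^sub>2) \<otimes> c)"
    using z by (intro reversal_mult reversal_inv reversal_letter) auto
  moreover have "c \<otimes> (inv z\<^sub>2 \<otimes> inv z\<^sub>1) = \<one>"
    using zG by (simp add: c_def word_simps)
  moreover have "(inv z\<^sub>1 \<otimes> inv z\<^sub>2) \<otimes> c \<noteq> \<one>"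
  proof
    assume "(inv z\<^sub>1 \<otimes> inv z\<^sub>2) \<otimes> c = \<one>"
    then have "(z\<^sub>2 \<otimes> z\<^sub>1) \<otimes> ((inv z\<^sub>1 \<otimes> inv z\<^sub>2) \<otimes> c) = z\<^sub>2 \<otimes> z\<^sub>1"
      using zG by simp
    then show False
      using zG z(3) by (simp add: c_def word_simps)
  qed
  ultimately show ?thesis
    using gen c by metis
qed

text \<open>The elements that have \<open>1\<close> as a reversal are palindromes and are closed under products. So it is enough
  to treat the conjugate of a commutator \<open>[b, c]\<close> by \<open>a\<close>. Using two different reversals of \<open>a\<close>, namely \<open>a'\<close>
  and \<open>q a'\<close>, for \<open>b\<close> and for \<open>c\<close> puts the reversals of their conjugates at different coordinates, where
  they commute, so that the commutator disappears from the reversed word.\<close>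

lemma (in wreath_product) base_derived_palindrome:
  assumes T: "generates A T" and Y: "generates B Y" and q: "is_reversal A T \<one>\<^bsub>A\<^esub> q" "q \<noteq> \<one>\<^bsub>A\<^esub>"
    and u: "u \<in> F" "\<And>x. x \<in> carrier A \<Longrightarrow> fst u x \<in> derived B (carrier B)"
  shows "u \<in> palindromes W (wreath_gens B A T Y)"
proof -
  let ?X = "wreath_gens B A T Y"
  interpret W: marked_group W ?X
    using T Y by (intro marked_group_wreath)
  have mA: "marked_group A T" and mB: "marked_group B Y"
    using T Y by unfold_locales
  interpret mA: marked_group A T by (rule mA)
  interpret mB: marked_group B Y by (rule mB)
  note topR = is_reversal_hom(1)[OF mA W.marked_group_axioms top_hom]
  note baseR = is_reversal_hom(1)[OF mB W.marked_group_axioms base_hom]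
  let ?R = "is_reversal W ?X"
  have qA: "q \<in> carrier A" using q(1) by (rule mA.reversal_closed)
  have derB: "derived B (carrier B) \<subseteq> carrier B"
    by (rule B.derived_in_carrier) simp
  have com: "?R (top a \<otimes>\<^bsub>W\<^esub> base (b \<otimes>\<^bsub>B\<^esub> c \<otimes>\<^bsub>B\<^esub> inv\<^bsub>B\<^esub> b \<otimes>\<^bsub>B\<^esub> inv\<^bsub>B\<^esub> c) \<otimes>\<^bsub>W\<^esub> inv\<^bsub>W\<^esub> top a) \<one>\<^bsub>W\<^esub>"
    if abc: "a \<in> carrier A" "b \<in> carrier B" "c \<in> carrier B" for a b c
  proof -
    obtain a' where a': "is_reversal A T a a'" using mA.reversal_exists abc(1) .
    obtain b' where b': "is_reversal B Y b b'" using mB.reversal_exists abc(2) .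
    obtain c' where c': "is_reversal B Y c c'" using mB.reversal_exists abc(3) .
    define x y r where "x = top a" and "y = top a'" and "r = top q"
    define u v where "u = base b" and "v = base c"
    define u' v' where "u' = base b'" and "v' = base c'"
    have cl: "a' \<in> carrier A" "b' \<in> carrier B" "c' \<in> carrier B"
      using mA.reversal_closed a' mB.reversal_closed b' c' by blast+
    have [simp]: "x \<in> carrier W" "y \<in> carrier W" "r \<in> carrier W" "u \<in> carrier W" "v \<in> carrier W"
        "u' \<in> carrier W" "v' \<in> carrier W"
      using abc cl qA by (simp_all add: x_def y_def r_def u_def v_def u'_def v'_def)
    have Rx: "?R x y" "?R \<one>\<^bsub>W\<^esub> r" "?R u u'" "?R v v'"
      using topR[OF _ a'] topR[OF _ q(1)] baseR[OF _ b'] baseR[OF _ c']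
      by (auto simp: x_def y_def r_def u_def v_def u'_def v'_def wreath_gens_def)
    have Rxr: "?R x (r \<otimes>\<^bsub>W\<^esub> y)"
      using W.reversal_mult[OF Rx(1,2)] by simp
    define U V where "U = x \<otimes>\<^bsub>W\<^esub> u \<otimes>\<^bsub>W\<^esub> inv\<^bsub>W\<^esub> x" and "V = x \<otimes>\<^bsub>W\<^esub> v \<otimes>\<^bsub>W\<^esub> inv\<^bsub>W\<^esub> x"
    define U' V' where "U' = inv\<^bsub>W\<^esub> y \<otimes>\<^bsub>W\<^esub> (u' \<otimes>\<^bsub>W\<^esub> y)"
      and "V' = inv\<^bsub>W\<^esub> (r \<otimes>\<^bsub>W\<^esub> y) \<otimes>\<^bsub>W\<^esub> (v' \<otimes>\<^bsub>W\<^esub> (r \<otimes>\<^bsub>W\<^esub> y))"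
    have [simp]: "U \<in> carrier W" "V \<in> carrier W" "U' \<in> carrier W" "V' \<in> carrier W"
      by (simp_all add: U_def V_def U'_def V'_def)
    have RU: "?R U U'"
      unfolding U_def V_def U'_def V'_def by (intro W.reversal_mult W.reversal_inv Rx)
    have RV: "?R V V'"
      unfolding U_def V_def U'_def V'_def by (intro W.reversal_mult W.reversal_inv Rx Rxr)
    have iq: "inv\<^bsub>A\<^esub> q \<in> carrier A" "r = inv\<^bsub>W\<^esub> top (inv\<^bsub>A\<^esub> q)" "inv\<^bsub>W\<^esub> r = top (inv\<^bsub>A\<^esub> q)"
      using qA by (simp_all add: x_def y_def r_def)
    \<comment> \<open>The supports are in the coordinates \<open>1\<close> and \<open>q\<^sup>-\<^sup>1\<close>.\<close>
    have "u' \<otimes>\<^bsub>W\<^esub> (inv\<^bsub>W\<^esub> r \<otimes>\<^bsub>W\<^esub> v' \<otimes>\<^bsub>W\<^esub> r) = (inv\<^bsub>W\<^esub> r \<otimes>\<^bsub>W\<^esub> v' \<otimes>\<^bsub>W\<^esub> r) \<otimes>\<^bsub>W\<^esub> u'"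
      unfolding iq(3) unfolding iq(2) u'_def v'_def
    proof (rule disjoint_support_commute[OF base_closed[OF cl(2)] conj_top_closed[OF iq(1) base_closed[OF cl(3)]]])
      fix z assume z: "z \<in> carrier A"
      show "fst (base b') z = \<one>\<^bsub>B\<^esub>
          \<or> fst (top (inv\<^bsub>A\<^esub> q) \<otimes>\<^bsub>W\<^esub> base c' \<otimes>\<^bsub>W\<^esub> inv\<^bsub>W\<^esub> top (inv\<^bsub>A\<^esub> q)) z = \<one>\<^bsub>B\<^esub>"
        unfolding conj_top_coord[OF iq(1) base_closed[OF cl(3)] z] using z qA q(2)
        by (auto simp: base_coord)
    qed
    then have "inv\<^bsub>W\<^esub> y \<otimes>\<^bsub>W\<^esub> (u' \<otimes>\<^bsub>W\<^esub> (inv\<^bsub>W\<^esub> r \<otimes>\<^bsub>W\<^esub> v' \<otimes>\<^bsub>W\<^esub> r)) \<otimes>\<^bsub>W\<^esub> y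
        = inv\<^bsub>W\<^esub> y \<otimes>\<^bsub>W\<^esub> ((inv\<^bsub>W\<^esub> r \<otimes>\<^bsub>W\<^esub> v' \<otimes>\<^bsub>W\<^esub> r) \<otimes>\<^bsub>W\<^esub> u') \<otimes>\<^bsub>W\<^esub> y"
      by simp
    then have UV: "U' \<otimes>\<^bsub>W\<^esub> V' = V' \<otimes>\<^bsub>W\<^esub> U'"
      by (simp add: U'_def V'_def W.word_simps)
    have "?R (U \<otimes>\<^bsub>W\<^esub> V \<otimes>\<^bsub>W\<^esub> inv\<^bsub>W\<^esub> U \<otimes>\<^bsub>W\<^esub> inv\<^bsub>W\<^esub> V) (inv\<^bsub>W\<^esub> V' \<otimes>\<^bsub>W\<^esub> (inv\<^bsub>W\<^esub> U' \<otimes>\<^bsub>W\<^esub> (V' \<otimes>\<^bsub>W\<^esub> U')))"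
      by (intro W.reversal_mult W.reversal_inv RU RV)
    moreover have "inv\<^bsub>W\<^esub> V' \<otimes>\<^bsub>W\<^esub> (inv\<^bsub>W\<^esub> U' \<otimes>\<^bsub>W\<^esub> (V' \<otimes>\<^bsub>W\<^esub> U')) = \<one>\<^bsub>W\<^esub>"
      unfolding UV[symmetric] by (simp add: W.word_simps)
    moreover have "U \<otimes>\<^bsub>W\<^esub> V \<otimes>\<^bsub>W\<^esub> inv\<^bsub>W\<^esub> U \<otimes>\<^bsub>W\<^esub> inv\<^bsub>W\<^esub> V
        = top a \<otimes>\<^bsub>W\<^esub> base (b \<otimes>\<^bsub>B\<^esub> c \<otimes>\<^bsub>B\<^esub> inv\<^bsub>B\<^esub> b \<otimes>\<^bsub>B\<^esub> inv\<^bsub>B\<^esub> c) \<otimes>\<^bsub>W\<^esub> inv\<^bsub>W\<^esub> top a"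
      using abc by (simp add: U_def V_def W.word_simps flip: x_def u_def v_def)
    ultimately show ?thesis by simp
  qed
  have piece: "?R (top a \<otimes>\<^bsub>W\<^esub> base b \<otimes>\<^bsub>W\<^esub> inv\<^bsub>W\<^esub> top a) \<one>\<^bsub>W\<^esub>"
    if a: "a \<in> carrier A" and b: "b \<in> derived B (carrier B)" for a b
    using b unfolding derived_def
  proof induction
    case one
    then show ?case using a W.reversal_one by simp
  next
    case (incl h)
    then show ?case using com[OF a] by auto
  next
    case (inv h)
    then obtain b c where h: "h = b \<otimes>\<^bsub>B\<^esub> c \<otimes>\<^bsub>B\<^esub> inv\<^bsub>B\<^esub> b \<otimes>\<^bsub>B\<^esub> inv\<^bsub>B\<^esub> c" "b \<in> carrier B" "c \<in> carrier B"
      by auto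
    then have "inv\<^bsub>B\<^esub> h = c \<otimes>\<^bsub>B\<^esub> b \<otimes>\<^bsub>B\<^esub> inv\<^bsub>B\<^esub> c \<otimes>\<^bsub>B\<^esub> inv\<^bsub>B\<^esub> b"
      by (simp add: B.word_simps)
    then show ?case using com[OF a h(3,2)] by simp
  next
    case (eng h k)
    have hk: "h \<in> carrier B" "k \<in> carrier B"
      using eng derB unfolding derived_def by auto
    have "top a \<otimes>\<^bsub>W\<^esub> base (h \<otimes>\<^bsub>B\<^esub> k) \<otimes>\<^bsub>W\<^esub> inv\<^bsub>W\<^esub> top a
        = (top a \<otimes>\<^bsub>W\<^esub> base h \<otimes>\<^bsub>W\<^esub> inv\<^bsub>W\<^esub> top a) \<otimes>\<^bsub>W\<^esub> (top a \<otimes>\<^bsub>W\<^esub> base k \<otimes>\<^bsub>W\<^esub> inv\<^bsub>W\<^esub> top a)"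
      using a hk by (simp add: W.word_simps)
    then show ?case
      using W.reversal_mult[OF eng.IH] by simp
  qed
  have "u \<in> {u. ?R u \<one>\<^bsub>W\<^esub>}"
  proof (rule base_group_induct[of _ "derived B (carrier B)"])
    fix v w assume "v \<in> {u. ?R u \<one>\<^bsub>W\<^esub>}" "w \<in> {u. ?R u \<one>\<^bsub>W\<^esub>}"
    then show "v \<otimes>\<^bsub>W\<^esub> w \<in> {u. ?R u \<one>\<^bsub>W\<^esub>}"
      using W.reversal_mult[of v "\<one>\<^bsub>W\<^esub>" w "\<one>\<^bsub>W\<^esub>"] by simp
  qed (use piece u derB W.reversal_one in auto)
  then show ?thesis
    using W.palindrome_mult_reversal[of u "\<one>\<^bsub>W\<^esub>"] u by simp
qed

text \<open>The part in the base group is one palindrome, and the part in the top group needs as many palindromes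
  as it needs in \<open>A\<close>.\<close>

lemma (in wreath_product) wreath_sub_derived_width:
  assumes T: "generates A T" "generates A Z" "Z \<subseteq> T" and Y: "generates B Y"
    and q: "is_reversal A T \<one>\<^bsub>A\<^esub> q" "q \<noteq> \<one>\<^bsub>A\<^esub>"
    and N: "carrier A \<subseteq> products_le A (palindromes A Z) (enat N)"
  shows "wreath_sub B A (derived B (carrier B))
    \<subseteq> products_le W (palindromes W (wreath_gens B A T Y)) (enat (N + 1))"
proof
  let ?X = "wreath_gens B A T Y"
  interpret W: marked_group W ?X
    using T Y by (intro marked_group_wreath)
  have mA: "marked_group A Z" using T by unfold_locales
  interpret mA: marked_group A Z by (rule mA)
  fix w assume "w \<in> wreath_sub B A (derived B (carrier B))"
  then have w: "w \<in> carrier W" "\<And>x. x \<in> carrier A \<Longrightarrow> fst w x \<in> derived B (carrier B)"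
    by (auto simp: wreath_sub_def)
  obtain u where u: "u \<in> F" "\<And>x. x \<in> carrier A \<Longrightarrow> fst u x = fst w x"
      "w = u \<otimes>\<^bsub>W\<^esub> top (snd w)" "snd w \<in> carrier A"
    using wreath_decompose[OF w(1)] by metis
  have "u \<in> palindromes W ?X"
    using u(1,2) w(2) by (intro base_derived_palindrome[OF T(1) Y q]) auto
  then have up: "u \<in> W.pal_products 1"
    by (rule W.palindromes_one)
  obtain ps where ps: "snd w = list_prod A ps" "set ps \<subseteq> palindromes A Z" "length ps \<le> N"
    using N u(4) by (auto simp: products_le_def)
  have "top ` Z \<subseteq> ?X"
    using T(3) by (auto simp: wreath_gens_def)
  then have pal: "top p \<in> palindromes W ?X" if "p \<in> palindromes A Z" for p
    using is_reversal_hom(2)[OF mA W.marked_group_axioms top_hom _ that] by blast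
  have top_ps: "top (list_prod A ps) = list_prod W (map top ps)"
    using ps(2) by (induction ps) (auto simp: subset_iff)
  have "top (snd w) \<in> W.pal_products N"
  proof -
    have "set (map top ps) \<subseteq> palindromes W ?X"
      using ps(2) pal by auto
    then have "list_prod W (map top ps) \<in> products_le W (palindromes W ?X) (enat N)"
      unfolding products_le_def using ps(3) by (auto intro!: exI[of _ "map top ps"] simp del: set_map)
    then show ?thesis using top_ps ps(1) by simp
  qed
  with up have "u \<otimes>\<^bsub>W\<^esub> top (snd w) \<in> W.pal_products (N + 1)"
    by (rule W.palindromes_mult) simp
  then show "w \<in> W.pal_products (N + 1)"
    by (subst u(3))
qed

section \<open>Wreath products with a finite group on top\<close>

lemma words_mono: "X \<subseteq> X' \<Longrightarrow> words X \<subseteq> words X'"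
  by (auto simp: words_def)

lemma palindromes_mono: "X \<subseteq> X' \<Longrightarrow> palindromes G X \<subseteq> palindromes G X'"
  unfolding palindromes_def using words_mono by blast

lemma generate_finite_subset:
  assumes "g \<in> generate G X"
  shows "\<exists>X0\<subseteq>X. finite X0 \<and> g \<in> generate G X0"
  using assms
proof induction
  case one
  show ?case by (intro exI[of _ "{}"]) (auto intro: generate.one)
next
  case (incl h)
  then show ?case by (intro exI[of _ "{h}"]) (auto intro: generate.incl)
next
  case (inv h)
  then show ?case by (intro exI[of _ "{h}"]) (auto intro: generate.inv)
next
  case (eng a b)
  then obtain X1 X2 where X12: "X1 \<subseteq> X" "finite X1" "a \<in> generate G X1"
      "X2 \<subseteq> X" "finite X2" "b \<in> generate G X2"
    by auto
  have mono: "x \<in> generate G (X1 \<union> X2)" if "x \<in> generate G X'" "X' \<subseteq> X1 \<union> X2" for x X'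
    using that by induction (auto intro: generate.intros)
  show ?case
    using X12 mono by (intro exI[of _ "X1 \<union> X2"]) (auto intro!: generate.eng)
qed

lemma (in group) finite_generating_subset:
  assumes "finite S" "generates G S" "generates G X"
  shows "\<exists>X0\<subseteq>X. finite X0 \<and> generates G X0"
proof -
  have "\<forall>s\<in>S. \<exists>X0\<subseteq>X. finite X0 \<and> s \<in> generate G X0"
  proof
    fix s assume "s \<in> S"
    then have "s \<in> generate G X" using assms by (auto simp: generates_def)
    then show "\<exists>X0\<subseteq>X. finite X0 \<and> s \<in> generate G X0" by (rule generate_finite_subset)
  qed
  then obtain f where f: "\<And>s. s \<in> S \<Longrightarrow> f s \<subseteq> X \<and> finite (f s) \<and> s \<in> generate G (f s)"
    by metis
  let ?X0 = "\<Union>s\<in>S. f s"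
  have X0: "?X0 \<subseteq> X" "finite ?X0" using f assms(1) by auto
  have X0G: "?X0 \<subseteq> carrier G" using X0 assms(3) by (auto simp: generates_def)
  have "S \<subseteq> generate G ?X0"
    using f mono_generate[of "f s" ?X0 for s] by blast
  then have "generate G S \<subseteq> generate G ?X0"
    by (intro generate_subgroup_incl generate_is_subgroup X0G)
  then have "generates G ?X0"
    using assms(2) X0G generate_incl[OF X0G] by (auto simp: generates_def)
  then show ?thesis using X0 by blast
qed

lemma (in marked_group) pal_products_exhaust:
  assumes "g \<in> carrier G"
  shows "\<exists>n. g \<in> pal_products n"
proof -
  have "g \<in> generate G X" using assms generating by (simp add: generates_def)
  then show ?thesis
  proof induction
    case one
    show ?case using products_le_one by blast
  next
    case (incl h)
    then show ?case using palindromes_one palindrome_letter by blast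
  next
    case (inv h)
    then show ?case using palindromes_one palindrome_letter palindrome_inv by blast
  next
    case (eng a b)
    then obtain m n where "a \<in> pal_products m" "b \<in> pal_products n" by blast
    then have "a \<otimes> b \<in> pal_products (m + n)" by (rule palindromes_mult) simp
    then show ?case by blast
  qed
qed

context wreath_product
begin

lemma coord_inv:
  assumes "u \<in> F" "x \<in> carrier A"
  shows "fst (inv\<^bsub>W\<^esub> u) x = inv\<^bsub>B\<^esub> fst u x"
proof -
  interpret F: normal F W by (rule F_normal)
  have "fst (u \<otimes>\<^bsub>W\<^esub> inv\<^bsub>W\<^esub> u) x = \<one>\<^bsub>B\<^esub>"
    using assms by (simp add: coord_one)
  then have "fst u x \<otimes>\<^bsub>B\<^esub> fst (inv\<^bsub>W\<^esub> u) x = \<one>\<^bsub>B\<^esub>"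
    unfolding coord_mult[OF assms] .
  then have "fst (inv\<^bsub>W\<^esub> u) x \<otimes>\<^bsub>B\<^esub> fst u x = \<one>\<^bsub>B\<^esub>"
    by (rule B.inv_comm) (use assms in auto)
  from B.inv_equality[OF this, symmetric] show ?thesis
    using assms by simp
qed

lemma derived_base_group_coord:
  assumes "d \<in> derived W F" "x \<in> carrier A"
  shows "fst d x \<in> derived B (carrier B)"
proof -
  interpret F: normal F W by (rule F_normal)
  interpret D: subgroup "derived B (carrier B)" B
    by (rule B.derived_is_subgroup) simp
  have com: "b \<otimes>\<^bsub>B\<^esub> c \<otimes>\<^bsub>B\<^esub> inv\<^bsub>B\<^esub> b \<otimes>\<^bsub>B\<^esub> inv\<^bsub>B\<^esub> c \<in> derived B (carrier B)"
    if "b \<in> carrier B" "c \<in> carrier B" for b c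
    using that unfolding derived_def by (intro generate.incl) blast
  have S: "subgroup {u \<in> F. fst u x \<in> derived B (carrier B)} W"
    by standard (use assms(2) in \<open>auto simp: coord_one coord_mult coord_inv\<close>)
  have "derived W F \<subseteq> {u \<in> F. fst u x \<in> derived B (carrier B)}"
    unfolding derived_def[of W]
  proof (rule W.generate_subgroup_incl[OF _ S], rule subsetI)
    fix d assume "d \<in> derived_set W F"
    then obtain u v where uv: "u \<in> F" "v \<in> F" "d = u \<otimes>\<^bsub>W\<^esub> v \<otimes>\<^bsub>W\<^esub> inv\<^bsub>W\<^esub> u \<otimes>\<^bsub>W\<^esub> inv\<^bsub>W\<^esub> v"
      by blast
    have "fst d x = fst u x \<otimes>\<^bsub>B\<^esub> fst v x \<otimes>\<^bsub>B\<^esub> inv\<^bsub>B\<^esub> fst u x \<otimes>\<^bsub>B\<^esub> inv\<^bsub>B\<^esub> fst v x"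
      unfolding uv(3) using uv(1,2) assms(2) by (simp add: coord_mult coord_inv)
    then show "d \<in> {u \<in> F. fst u x \<in> derived B (carrier B)}"
      using com[of "fst u x" "fst v x"] uv assms(2) by simp
  qed
  then show ?thesis using assms(1) by blast
qed

text \<open>The base group is generated by the finitely many conjugates \<open>a y a\<^sup>-\<^sup>1\<close>, hence modulo its derived subgroup
  it is a product of finitely many cyclic groups. Since \<open>A\<close> is finite, there is a common bound \<open>L\<close> for the
  numbers of palindromes that the conjugating elements \<open>a\<close> need, so that \<open>a y\<^sup>n a\<^sup>-\<^sup>1\<close> needs at most \<open>2 L + 1\<close>.
  Elements of the derived subgroup are single palindromes.\<close>

lemma finite_top_width:
  assumes fin: "finite (carrier A)" and T: "generates A T" and Y: "generates B Y" "finite Y"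
    and q: "is_reversal A T \<one>\<^bsub>A\<^esub> q" "q \<noteq> \<one>\<^bsub>A\<^esub>"
  shows "\<exists>N. carrier W \<subseteq> products_le W (palindromes W (wreath_gens B A T Y)) (enat N)"
proof -
  interpret F: normal F W by (rule F_normal)
  let ?X = "wreath_gens B A T Y"
  interpret W: marked_group W ?X
    using T Y by (intro marked_group_wreath)
  let ?D = "derived W F"
  have DW: "?D \<lhd> W" by (rule W.derived_is_normal[OF F_normal])
  have DF: "?D \<subseteq> F" by (rule W.derived_incl[OF subset_refl F.is_subgroup])
  have com: "a \<otimes>\<^bsub>W\<^esub> b \<otimes>\<^bsub>W\<^esub> inv\<^bsub>W\<^esub> a \<otimes>\<^bsub>W\<^esub> inv\<^bsub>W\<^esub> b \<in> ?D" if "a \<in> F" "b \<in> F" for a b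
    using that unfolding derived_def by (intro generate.incl) blast
  have D_pal: "?D \<subseteq> W.pal_products 1"
    using base_derived_palindrome[OF T Y(1) q] DF derived_base_group_coord W.palindromes_one by blast
  have YB: "Y \<subseteq> carrier B" "generate B Y = carrier B"
    using Y by (auto simp: generates_def)
  have "\<forall>a\<in>carrier A. \<exists>n. top a \<in> W.pal_products n"
    using W.pal_products_exhaust by auto
  then obtain l where l: "\<And>a. a \<in> carrier A \<Longrightarrow> top a \<in> W.pal_products (l a)"
    by metis
  define L where "L = Max (l ` carrier A)"
  have L: "top a \<in> W.pal_products L" if "a \<in> carrier A" for a
    using l[OF that] products_le_mono[OF subset_refl, of "enat (l a)" "enat L" W] fin that
    by (auto simp: L_def)
  have conj_hom: "group_hom B W (\<lambda>b. top a \<otimes>\<^bsub>W\<^esub> base b \<otimes>\<^bsub>W\<^esub> inv\<^bsub>W\<^esub> top a)" if a: "a \<in> carrier A" for a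
    using a by unfold_locales (auto intro!: homI simp: W.word_simps)
  define p where "p = (\<lambda>(a, y). top a \<otimes>\<^bsub>W\<^esub> base y \<otimes>\<^bsub>W\<^esub> inv\<^bsub>W\<^esub> top a)"
  have pF: "p i \<in> F" if "i \<in> carrier A \<times> Y" for i
    using that YB by (auto simp: p_def intro!: conj_top_closed base_closed)
  have p_pal: "p i [^]\<^bsub>W\<^esub> (n::int) \<in> W.pal_products (2 * L + 1)" if i: "i \<in> carrier A \<times> Y" for i n
  proof -
    obtain a y where ay: "i = (a, y)" "a \<in> carrier A" "y \<in> Y" using i by auto
    interpret c: group_hom B W "\<lambda>b. top a \<otimes>\<^bsub>W\<^esub> base b \<otimes>\<^bsub>W\<^esub> inv\<^bsub>W\<^esub> top a"
      by (rule conj_hom[OF ay(2)])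
    have yB: "y \<in> carrier B" using ay YB by auto
    have "base y [^]\<^bsub>W\<^esub> n \<in> W.pal_products 1"
      using ay by (intro W.palindromes_one W.palindrome_int_pow) (auto simp: wreath_gens_def)
    then have "top a \<otimes>\<^bsub>W\<^esub> base y [^]\<^bsub>W\<^esub> n \<otimes>\<^bsub>W\<^esub> top (inv\<^bsub>A\<^esub> a) \<in> W.pal_products (2 * L + 1)"
      by (rule W.palindromes_mult[OF W.palindromes_mult[OF L[OF ay(2)] _ order_refl] L])
        (use ay in auto)
    then show ?thesis
      using c.hom_int_pow[OF yB, of n] base.hom_int_pow[OF yB, of n] ay by (simp add: p_def)
  qed
  define N where "N = (\<lambda>i. ?D <#>\<^bsub>W\<^esub> generate W {p i})"
  have N: "subgroup (N i) W" "?D \<subseteq> N i" "N i \<subseteq> F" "p i \<in> N i"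
    "N i \<subseteq> W.pal_products (2 * L + 1) <#>\<^bsub>W\<^esub> ?D" if "i \<in> carrier A \<times> Y" for i
    unfolding N_def
    by ((rule W.cyclic_piece[OF DW F.is_subgroup DF pF p_pal]; rule that))+
  let ?I = "carrier A \<times> Y"
  let ?M = "generate W (\<Union>i\<in>?I. N i)"
  have M_pal: "?M \<subseteq> W.pal_products (\<Sum>i\<in>?I. 2 * L + 1) <#>\<^bsub>W\<^esub> ?D"
    using N fin Y by (intro W.generate_pal_products_mod[OF F.is_subgroup DW com]) auto
  interpret M: subgroup ?M W
    using N(3) F.subset by (intro W.generate_is_subgroup) blast
  have piece: "top a \<otimes>\<^bsub>W\<^esub> base b \<otimes>\<^bsub>W\<^esub> inv\<^bsub>W\<^esub> top a \<in> ?M" if ab: "a \<in> carrier A" "b \<in> carrier B" for a b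
  proof -
    interpret c: group_hom B W "\<lambda>b. top a \<otimes>\<^bsub>W\<^esub> base b \<otimes>\<^bsub>W\<^esub> inv\<^bsub>W\<^esub> top a"
      by (rule conj_hom[OF ab(1)])
    have "p (a, y) \<in> ?M" if "y \<in> Y" for y
      using N(4)[of "(a, y)"] ab that by (auto intro: generate.incl)
    then have "generate W ((\<lambda>b. top a \<otimes>\<^bsub>W\<^esub> base b \<otimes>\<^bsub>W\<^esub> inv\<^bsub>W\<^esub> top a) ` Y) \<subseteq> ?M"
      by (intro W.generate_subgroup_incl M.is_subgroup) (auto simp: p_def)
    then show ?thesis
      using c.generate_img[OF YB(1)] YB(2) ab by blast
  qed
  have FM: "u \<in> ?M" if u: "u \<in> F" for u
    by (rule base_group_induct[of ?M "carrier B"])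
      (use u piece in \<open>auto intro: M.one_closed M.m_closed\<close>)
  let ?n = "\<Sum>i\<in>?I. 2 * L + 1"
  have "w \<in> W.pal_products (?n + 1 + L)" if w: "w \<in> carrier W" for w
  proof -
    obtain u where u: "u \<in> F" "w = u \<otimes>\<^bsub>W\<^esub> top (snd w)" "snd w \<in> carrier A"
      using wreath_decompose[OF w] by metis
    obtain r d where rd: "r \<in> W.pal_products ?n" "d \<in> ?D" "u = r \<otimes>\<^bsub>W\<^esub> d"
      using FM[OF u(1)] M_pal by (auto simp: set_mult_def)
    have "d \<in> W.pal_products 1" using rd D_pal by blast
    then have "u \<in> W.pal_products (?n + 1)"
      unfolding rd(3) by (rule W.palindromes_mult[OF rd(1) _ order_refl])
    then have "u \<otimes>\<^bsub>W\<^esub> top (snd w) \<in> W.pal_products (?n + 1 + L)"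
      by (rule W.palindromes_mult[OF _ L[OF u(3)] order_refl])
    then show ?thesis by (subst u(2))
  qed
  then show ?thesis by blast
qed

end

section \<open>The group of integer tuples\<close>

lemma comm_group_int_power: "comm_group (int_power k)"
proof (rule group.group_comm_groupI)
  show "group (int_power k)"
    by (simp add: int_power_def group_integer_group)
  fix f g assume "f \<in> carrier (int_power k)" "g \<in> carrier (int_power k)"
  show "f \<otimes>\<^bsub>int_power k\<^esub> g = g \<otimes>\<^bsub>int_power k\<^esub> f"
    by (auto simp: int_power_def integer_group_def intro!: restrict_ext)
qed

lemma carrier_int_power: "carrier (int_power k) = {..<k} \<rightarrow>\<^sub>E UNIV"
  by (simp add: int_power_def integer_group_def)

lemma infinite_int_power:
  assumes "k \<ge> 1"
  shows "infinite (carrier (int_power k))"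
proof
  assume "finite (carrier (int_power k))"
  then have "finite ((\<lambda>f. f 0) ` carrier (int_power k))" by simp
  moreover have "(\<lambda>f. f 0) ` carrier (int_power k) = (UNIV :: int set)"
  proof -
    have "n \<in> (\<lambda>f. f 0) ` carrier (int_power k)" for n
      using assms by (intro image_eqI[of _ _ "\<lambda>j\<in>{..<k}. n"]) (auto simp: carrier_int_power)
    then show ?thesis by auto
  qed
  ultimately show False by (simp add: infinite_UNIV_int)
qed

definition unit_tuple :: "nat \<Rightarrow> nat \<Rightarrow> nat \<Rightarrow> int" where
  "unit_tuple k i = (\<lambda>j\<in>{..<k}. if j = i then 1 else 0)"

lemma std_basis_eq: "std_basis k = unit_tuple k ` {..<k}"
  by (auto simp: std_basis_def unit_tuple_def)

lemma finite_std_basis: "finite (std_basis k)"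
  by (simp add: std_basis_eq)

lemma card_std_basis: "card (std_basis k) = k"
proof -
  have "inj_on (unit_tuple k) {..<k}"
  proof (rule inj_onI)
    fix i j assume "i \<in> {..<k}" "j \<in> {..<k}" "unit_tuple k i = unit_tuple k j"
    then have "unit_tuple k i i = unit_tuple k j i" "i < k" by auto
    then show "i = j" by (simp add: unit_tuple_def split: if_splits)
  qed
  then show ?thesis by (simp add: std_basis_eq card_image)
qed

lemma int_power_pow:
  assumes "f \<in> carrier (int_power k)"
  shows "f [^]\<^bsub>int_power k\<^esub> (n::int) = (\<lambda>j\<in>{..<k}. n * f j)"
proof -
  interpret comm_group "int_power k" by (rule comm_group_int_power)
  have "(f [^]\<^bsub>int_power k\<^esub> n) j = n * f j" if j: "j < k" for j
  proof -
    have "group_hom (int_power k) integer_group (\<lambda>f. f j)"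
    proof (intro group_hom.intro group_hom_axioms.intro homI is_group group_integer_group)
      show "(f \<otimes>\<^bsub>int_power k\<^esub> g) j = f j \<otimes>\<^bsub>integer_group\<^esub> g j" for f g
        using j by (simp add: int_power_def)
    qed (simp add: integer_group_def)
    then show ?thesis
      using group_hom.hom_int_pow[of "int_power k" integer_group "\<lambda>f. f j" f n] assms by simp
  qed
  moreover have "f [^]\<^bsub>int_power k\<^esub> n \<in> carrier (int_power k)"
    using assms by simp
  ultimately show ?thesis
    by (auto simp: carrier_int_power PiE_iff extensional_def fun_eq_iff)
qed

text \<open>A tuple is built up from its truncations to the first \<open>m\<close> coordinates, by induction on \<open>m\<close>.\<close>

lemma generates_std_basis: "generates (int_power k) (std_basis k)"
proof -
  interpret comm_group "int_power k" by (rule comm_group_int_power)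
  have B: "std_basis k \<subseteq> carrier (int_power k)"
    by (auto simp: std_basis_def carrier_int_power split: if_splits)
  interpret S: subgroup "generate (int_power k) (std_basis k)" "int_power k"
    by (rule generate_is_subgroup[OF B])
  have "(\<lambda>j\<in>{..<k}. if j < m then f j else 0) \<in> generate (int_power k) (std_basis k)"
    if "m \<le> k" for f :: "nat \<Rightarrow> int" and m
    using that
  proof (induction m)
    case 0
    have "(\<lambda>j\<in>{..<k}. if j < 0 then f j else 0) = \<one>\<^bsub>int_power k\<^esub>"
      by (auto simp: int_power_def integer_group_def)
    then show ?case using S.one_closed by simp
  next
    case (Suc m)
    have u: "unit_tuple k m \<in> std_basis k" using Suc.prems by (auto simp: std_basis_eq)
    then have uG: "unit_tuple k m \<in> carrier (int_power k)" using B by blast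
    have "(\<lambda>j\<in>{..<k}. if j < Suc m then f j else 0)
        = (\<lambda>j\<in>{..<k}. if j < m then f j else 0) \<otimes>\<^bsub>int_power k\<^esub> (unit_tuple k m [^]\<^bsub>int_power k\<^esub> f m)"
      unfolding int_power_pow[OF uG]
      by (auto simp: int_power_def integer_group_def unit_tuple_def less_Suc_eq intro!: restrict_ext)
    moreover have "unit_tuple k m [^]\<^bsub>int_power k\<^esub> f m \<in> generate (int_power k) (std_basis k)"
      by (intro subgroup_int_pow_closed S.is_subgroup generate.incl u)
    moreover have "(\<lambda>j\<in>{..<k}. if j < m then f j else 0) \<in> generate (int_power k) (std_basis k)"
      using Suc.prems by (intro Suc.IH) simp
    ultimately show ?case by (simp only: S.m_closed)
  qed
  moreover have "(\<lambda>j\<in>{..<k}. if j < k then f j else 0) = f" if "f \<in> carrier (int_power k)" for f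
    using that by (auto simp: carrier_int_power PiE_iff extensional_def fun_eq_iff)
  ultimately have "carrier (int_power k) \<subseteq> generate (int_power k) (std_basis k)"
    by (metis le_refl subsetI)
  then show ?thesis
    using B S.subset by (auto simp: generates_def)
qed


section \<open>The five bounds\<close>

lemma (in group) comm_group_if_no_generators:
  assumes "generates G {}"
  shows "comm_group G"
proof (rule group_comm_groupI)
  have "carrier G = {\<one>}" using assms by (auto simp: generates_def generate_empty)
  then show "\<And>x y. x \<in> carrier G \<Longrightarrow> y \<in> carrier G \<Longrightarrow> x \<otimes> y = y \<otimes> x" by auto
qed

lemma (in group) comm_group_if_commutator_width_0:
  assumes "commutator_width G = enat 0"
  shows "comm_group G"
proof (rule group_comm_groupI)
  fix x y assume xy: "x \<in> carrier G" "y \<in> carrier G"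
  then have "x \<otimes> y \<otimes> inv x \<otimes> inv y \<in> derived G (carrier G)"
    unfolding derived_def by (intro generate.incl) blast
  then have "x \<otimes> y \<otimes> inv x \<otimes> inv y \<in> products_le G (derived_set G (carrier G)) (enat 0)"
    using width_attained[OF assms[unfolded commutator_width_def]] by blast
  then have "x \<otimes> y \<otimes> inv x \<otimes> inv y = \<one>"
    by (auto simp: products_le_def)
  then have "(x \<otimes> y \<otimes> inv x \<otimes> inv y) \<otimes> (y \<otimes> x) = y \<otimes> x"
    using xy by simp
  then show "x \<otimes> y = y \<otimes> x"
    using xy by (simp add: word_simps)
qed

lemma finite_pw_imp_pw:
  assumes "finite_pw G X"
  obtains N where "pw G X = enat N" "carrier G \<subseteq> products_le G (palindromes G X) (enat N)"
proof -
  obtain M where "carrier G \<subseteq> products_le G (palindromes G X) (enat M)"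
    using assms by (auto simp: finite_pw_def)
  then have "pw G X \<le> enat M"
    unfolding pw_def by (rule width_leI)
  then obtain N where N: "pw G X = enat N"
    by (cases "pw G X") auto
  then show thesis
    using that width_attained unfolding pw_def by blast
qed

lemma wreath_sub_derived_pw:
  assumes G: "group G" "generates G Y" and H: "group H" "\<not> comm_group H" "generates H Z" "finite_pw H Z"
  shows "\<exists>c\<in>carrier H. wreath_sub G H (derived G (carrier G))
    \<subseteq> products_le (G \<wr> H) (palindromes (G \<wr> H) (wreath_gens G H (Z \<union> {c}) Y)) (pw H Z + 1)"
proof -
  interpret wreath_product G H
    using G H by (simp add: wreath_product_def)
  obtain c q where c: "c \<in> carrier H" "generates H (Z \<union> {c})" "q \<noteq> \<one>\<^bsub>H\<^esub>"
      "is_reversal H (Z \<union> {c}) \<one>\<^bsub>H\<^esub> q"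
    using A.nontrivial_reversal_of_one[OF H(2,3)] by blast
  obtain N where "pw H Z = enat N" "carrier H \<subseteq> products_le H (palindromes H Z) (enat N)"
    using finite_pw_imp_pw[OF H(4)] .
  then show ?thesis
    using wreath_sub_derived_width[OF c(2) H(3) _ G(2) c(4,3)] c(1)
    by (intro bexI[of _ c]) (auto simp: one_enat_def)
qed

lemma perfect_wreath_pw:
  assumes P: "group P" "perfect P" "generates P S"
    and H: "group H" "\<not> comm_group H" "generates H Z" "finite_pw H Z"
  shows "\<exists>c\<in>carrier H. pw (P \<wr> H) (wreath_gens P H (Z \<union> {c}) S) \<le> pw H Z + 1"
proof -
  interpret wreath_product P H
    using P H by (simp add: wreath_product_def)
  have "wreath_sub P H (derived P (carrier P)) = carrier W"
    using P(2) coord_closed by (force simp: wreath_sub_def perfect_def)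
  moreover obtain N where "pw H Z + 1 = enat (N + 1)"
    using finite_pw_imp_pw[OF H(4)] by (metis one_enat_def plus_enat_simps(1))
  ultimately show ?thesis
    using wreath_sub_derived_pw[OF P(1,3) H] unfolding pw_def[of W] by (metis width_leI)
qed

text \<open>A finitely generated group has a finite generating subset \<open>X0\<close> in every generating set \<open>X\<close>, and
  palindromes in \<open>X0\<close> are palindromes in \<open>X\<close>. So \<open>X\<close> may be infinite.\<close>

lemma finite_top_finite_pw:
  assumes K: "group K" "\<not> comm_group K" "finite (carrier K)" "generates K Z"
    and G: "group G" "d_generated d G"
  shows "\<exists>c\<in>carrier K. \<forall>X. generates G X \<longrightarrow> finite_pw (G \<wr> K) (wreath_gens G K (Z \<union> {c}) X)"
proof -
  interpret wreath_product G K
    using G K by (simp add: wreath_product_def)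
  obtain c q where c: "c \<in> carrier K" "generates K (Z \<union> {c})" "q \<noteq> \<one>\<^bsub>K\<^esub>"
      "is_reversal K (Z \<union> {c}) \<one>\<^bsub>K\<^esub> q"
    using A.nontrivial_reversal_of_one[OF K(2,4)] by blast
  obtain S where S: "finite S" "generates G S"
    using G(2) by (auto simp: d_generated_def)
  have "finite_pw W (wreath_gens G K (Z \<union> {c}) X)" if X: "generates G X" for X
  proof -
    obtain X0 where X0: "X0 \<subseteq> X" "finite X0" "generates G X0"
      using B.finite_generating_subset[OF S X] by blast
    obtain N where N: "carrier W
        \<subseteq> products_le W (palindromes W (wreath_gens G K (Z \<union> {c}) X0)) (enat N)"
      using finite_top_width[OF K(3) c(2) X0(3,2) c(4,3)] by blast
    have "wreath_gens G K (Z \<union> {c}) X0 \<subseteq> wreath_gens G K (Z \<union> {c}) X"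
      using X0(1) by (auto simp: wreath_gens_def)
    from products_le_mono[OF palindromes_mono[OF this] order_refl] show ?thesis
      unfolding finite_pw_def using N by blast
  qed
  then show ?thesis using c(1) by blast
qed

text \<open>A group that is not abelian has a generator, so \<open>4 |X| \<ge> 4\<close>. With \<open>5 k \<ge> 10\<close> for even \<open>k\<close>, and with
  \<open>5 k + 2 \<ge> 7\<close> for odd \<open>k\<close>, this leaves room for the ten palindromes of the derived subgroup.\<close>

lemma pw_wreath_int_power:
  assumes "group G" "generates G X" "finite X" "k \<ge> 1"
  shows "pw (G \<wr> int_power k) (wreath_gens G (int_power k) (std_basis k) X)
    \<le> enat (5 * card X + 9 * k + (if even k then 0 else 2))"
proof -
  interpret A: comm_group "int_power k" by (rule comm_group_int_power)
  interpret wreath_product G "int_power k"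
    using assms(1) by (simp add: wreath_product_def A.is_group)
  have "card X \<ge> 1" if "\<not> comm_group G"
    using that B.comm_group_if_no_generators assms by (cases "X = {}") (auto simp: Suc_le_eq card_gt_0_iff)
  moreover have "k \<ge> 2" if "even k" using that \<open>k \<ge> 1\<close> by presburger
  ultimately have "card X + 4 * k + (if comm_group G then 0 else 10)
      \<le> 5 * card X + 9 * k + (if even k then 0 else 2)"
    using \<open>k \<ge> 1\<close> by (cases "comm_group G"; cases "even k") auto
  then have "enat (card X + 4 * card (std_basis k) + (if comm_group G then 0 else 10))
      \<le> enat (5 * card X + 9 * k + (if even k then 0 else 2))"
    by (simp only: card_std_basis enat_ord_simps)
  with pw_abelian_top[OF comm_group_int_power infinite_int_power[OF \<open>k \<ge> 1\<close>]
        generates_std_basis finite_std_basis assms(2,3)]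
  show ?thesis by (rule order_trans)
qed

text \<open>If \<open>C\<close> is not abelian, then \<open>|Y| \<ge> 1\<close> and \<open>n \<ge> 1\<close>, hence \<open>4 |Y| + 7 n \<ge> 11\<close> leaves room for the ten
  palindromes of the derived subgroup. These do not depend on \<open>n\<close>.\<close>

lemma pw_wreath_commutator_width:
  assumes A: "comm_group A" "infinite (carrier A)" "generates A T" "finite T"
    and C: "group C" "commutator_width C = enat n" "generates C Y" "finite Y"
  shows "pw (C \<wr> A) (wreath_gens C A T Y) \<le> enat (5 * card Y + 6 * card T + 7 * n)"
proof -
  interpret wreath_product C A
    using A(1) C(1) by (simp add: wreath_product_def comm_group.axioms(2))
  have "card Y \<ge> 1" "n \<ge> 1" if "\<not> comm_group C"
    using that B.comm_group_if_no_generators B.comm_group_if_commutator_width_0 C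
    by (cases "Y = {}"; cases "n = 0"; auto simp: Suc_le_eq card_gt_0_iff)+
  then have "card Y + 4 * card T + (if comm_group C then 0 else 10)
      \<le> 5 * card Y + 6 * card T + 7 * n"
    by (cases "comm_group C") auto
  then have "enat (card Y + 4 * card T + (if comm_group C then 0 else 10))
      \<le> enat (5 * card Y + 6 * card T + 7 * n)"
    by (simp only: enat_ord_simps)
  with pw_abelian_top[OF A C(3,4)] show ?thesis by (rule order_trans)
qed

theorem theorem1p1:
  shows
    "(\<forall>(G :: ('a1, 'm1) monoid_scheme) X d k.
        group G \<and> generates G X \<and> finite X \<and> card X = d \<and> k \<ge> 1 \<longrightarrow>
        (even k \<longrightarrow> pw (G \<wr> int_power k) (wreath_gens G (int_power k) (std_basis k) X)
                     \<le> enat (5 * d + 9 * k)) \<and>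
        (odd k \<longrightarrow> pw (G \<wr> int_power k) (wreath_gens G (int_power k) (std_basis k) X)
                     \<le> enat (5 * d + 9 * k + 2)))
   \<and> (\<forall>(A :: ('a2, 'm2) monoid_scheme) T r (C :: ('b2, 'n2) monoid_scheme) n Y.
        comm_group A \<and> infinite (carrier A) \<and> generates A T \<and> finite T \<and> card T = r \<and>
        group C \<and> finitely_generated C \<and> commutator_width C = enat n \<and>
        finite Y \<and> generates C Y \<longrightarrow>
        pw (C \<wr> A) (wreath_gens C A T Y) \<le> enat (5 * card Y + 6 * r + 7 * n))
   \<and> (\<forall>(G :: ('a3, 'm3) monoid_scheme) Y (H :: ('b3, 'n3) monoid_scheme) Z.
        group G \<and> finitely_generated G \<and> generates G Y \<and>
        group H \<and> \<not> comm_group H \<and> finitely_generated H \<and> generates H Z \<and> finite_pw H Z \<longrightarrow>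
        (\<exists>c\<in>carrier H. \<forall>g\<in>wreath_sub G H (derived G (carrier G)).
           g \<in> products_le (G \<wr> H) (palindromes (G \<wr> H) (wreath_gens G H (Z \<union> {c}) Y))
                 (pw H Z + 1)))
   \<and> (\<forall>(P :: ('a4, 'm4) monoid_scheme) (H :: ('b4, 'n4) monoid_scheme) Z S.
        group P \<and> finitely_generated P \<and> perfect P \<and>
        group H \<and> \<not> comm_group H \<and> finitely_generated H \<and> generates H Z \<and> finite_pw H Z \<and>
        generates P S \<longrightarrow>
        (\<exists>c\<in>carrier H. pw (P \<wr> H) (wreath_gens P H (Z \<union> {c}) S) \<le> pw H Z + 1))
   \<and> (\<forall>(K :: ('a5, 'm5) monoid_scheme) (G :: ('b5, 'n5) monoid_scheme) d Z.
        group K \<and> \<not> comm_group K \<and> finite (carrier K) \<and> group G \<and> d_generated d G \<and>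
        generates K Z \<longrightarrow>
        (\<exists>c\<in>carrier K. \<forall>X. generates G X \<longrightarrow>
           finite_pw (G \<wr> K) (wreath_gens G K (Z \<union> {c}) X)))"
proof (intro conjI allI impI)
  fix G :: "('a1, 'm1) monoid_scheme" and X and d k :: nat
  assume *: "group G \<and> generates G X \<and> finite X \<and> card X = d \<and> k \<ge> 1"
  show "even k \<Longrightarrow> pw (G \<wr> int_power k) (wreath_gens G (int_power k) (std_basis k) X)
      \<le> enat (5 * d + 9 * k)"
    and "odd k \<Longrightarrow> pw (G \<wr> int_power k) (wreath_gens G (int_power k) (std_basis k) X)
      \<le> enat (5 * d + 9 * k + 2)"
    using pw_wreath_int_power[of G X k] * by auto
next
  fix A :: "('a2, 'm2) monoid_scheme" and T r and C :: "('b2, 'n2) monoid_scheme" and n Y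
  assume *: "comm_group A \<and> infinite (carrier A) \<and> generates A T \<and> finite T \<and> card T = r \<and>
    group C \<and> finitely_generated C \<and> commutator_width C = enat n \<and> finite Y \<and> generates C Y"
  show "pw (C \<wr> A) (wreath_gens C A T Y) \<le> enat (5 * card Y + 6 * r + 7 * n)"
    using pw_wreath_commutator_width[of A T C n Y] * by blast
next
  fix G :: "('a3, 'm3) monoid_scheme" and Y and H :: "('b3, 'n3) monoid_scheme" and Z
  assume *: "group G \<and> finitely_generated G \<and> generates G Y \<and>
    group H \<and> \<not> comm_group H \<and> finitely_generated H \<and> generates H Z \<and> finite_pw H Z"
  show "\<exists>c\<in>carrier H. \<forall>g\<in>wreath_sub G H (derived G (carrier G)).
      g \<in> products_le (G \<wr> H) (palindromes (G \<wr> H) (wreath_gens G H (Z \<union> {c}) Y)) (pw H Z + 1)"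
    using wreath_sub_derived_pw[of G Y H Z, unfolded subset_eq] * by blast
next
  fix P :: "('a4, 'm4) monoid_scheme" and H :: "('b4, 'n4) monoid_scheme" and Z S
  assume *: "group P \<and> finitely_generated P \<and> perfect P \<and>
    group H \<and> \<not> comm_group H \<and> finitely_generated H \<and> generates H Z \<and> finite_pw H Z \<and> generates P S"
  show "\<exists>c\<in>carrier H. pw (P \<wr> H) (wreath_gens P H (Z \<union> {c}) S) \<le> pw H Z + 1"
    by (rule perfect_wreath_pw) (use * in auto)
next
  fix K :: "('a5, 'm5) monoid_scheme" and G :: "('b5, 'n5) monoid_scheme" and d Z
  assume *: "group K \<and> \<not> comm_group K \<and> finite (carrier K) \<and> group G \<and> d_generated d G \<and> generates K Z"
  show "\<exists>c\<in>carrier K. \<forall>X. generates G X \<longrightarrow> finite_pw (G \<wr> K) (wreath_gens G K (Z \<union> {c}) X)"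
    by (rule finite_top_finite_pw) (use * in auto)
qed

end
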